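(* Let $s,p,K$ satisfy the standing assumptions (S), let $\Omega\subset\mathbb R^n$ be bounded, open and Lipschitz, and let $g\in\mathbb W^{s(\cdot,\cdot),p(\cdot,\cdot)}(\Omega)$. Then there exists a unique $u\in\mathbb W^{s(\cdot,\cdot),p(\cdot,\cdot)}(\Omega)$ with $u=g$ a.e. in $\mathbb R^n\setminus\Omega$ that minimizes $$\mathcal E(v;\Omega):=\iint_{\mathcal C_\Omega}\frac{1}{p(x,y)}|v(x)-v(y)|^{p(x,y)}K(x,y)\,dy\,dx$$ among all $v\in\mathbb W^{s(\cdot,\cdot),p(\cdot,\cdot)}(\Omega)$ with $v=g$ a.e. in $\mathbb R^n\setminus\Omega$. Moreover, if $p^+-1<\frac{np^-}{n-s^-p^-}$ or $s^-p^-\ge n$, and if in addition $g\in L^\infty(\Omega;L^{p(\cdot,\cdot)-1}_{s(\cdot,\cdot)p(\cdot,\cdot)}(\mathbb R^n))$, then this minimizer $u$ also belongs to $L^\infty(\Omega;L^{p(\cdot,\cdot)-1}_{s(\cdot,\cdot)p(\cdot,\cdot)}(\mathbb R^n))$.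
   Context: Standing assumptions (S): $s,p:\mathbb R^n\times\mathbb R^n\to\mathbb R$ symmetric, $0<s^-:=\inf s\le\sup s=:s^+<1$, $1<p^-:=\inf p\le\sup p=:p^+<\infty$; $K$ measurable, symmetric, $\Lambda^{-1}|x-y|^{-n-s(x,y)p(x,y)}\le K(x,y)\le\Lambda|x-y|^{-n-s(x,y)p(x,y)}$ a.e. for some $\Lambda>1$. $\mathcal C_\Omega:=(\mathbb R^n\times\mathbb R^n)\setminus((\mathbb R^n\setminus\Omega)\times(\mathbb R^n\setminus\Omega))$; $p^-_\Omega:=\inf_{\Omega\times\Omega}p$. $\mathbb W^{s(\cdot,\cdot),p(\cdot,\cdot)}(\Omega)$: measurable $v:\mathbb R^n\to\mathbb R$ with $v|_\Omega\in L^{p^-_\Omega}(\Omega)$ and $\iint_{\mathcal C_\Omega}\frac{|v(x)-v(y)|^{p(x,y)}}{|x-y|^{n+s(x,y)p(x,y)}}dy\,dx<\infty$. $L^\infty(\Omega;L^{p(\cdot,\cdot)-1}_{s(\cdot,\cdot)p(\cdot,\cdot)}(\mathbb R^n))$: measurable $v$ with $\operatorname{ess\,sup}_{x\in\Omega}\int_{\mathbb R^n}\frac{|v(y)|^{p(x,y)-1}}{(1+|y|)^{n+s(x,y)p(x,y)}}dy<\infty$. *)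

theory Defs
  imports "HOL-Analysis.Analysis"
begin

definition inf_fun :: "('a \<Rightarrow> 'a \<Rightarrow> real) \<Rightarrow> real" where
  "inf_fun f = Inf (range (\<lambda>(x, y). f x y))"

definition sup_fun :: "('a \<Rightarrow> 'a \<Rightarrow> real) \<Rightarrow> real" where
  "sup_fun f = Sup (range (\<lambda>(x, y). f x y))"

definition inf_on :: "('a \<Rightarrow> 'a \<Rightarrow> real) \<Rightarrow> 'a set \<Rightarrow> real" where
  "inf_on f \<Omega> = Inf ((\<lambda>(x, y). f x y) ` (\<Omega> \<times> \<Omega>))"

definition C_set :: "'a set \<Rightarrow> ('a \<times> 'a) set" where
  "C_set \<Omega> = UNIV - ((UNIV - \<Omega>) \<times> (UNIV - \<Omega>))"

text \<open>Bounded-graph (strong) Lipschitz boundary: near every boundary point,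
  after a rotation, Omega is the region above the graph of a Lipschitz function
  defined on a hyperplane. Coordinate-free: e is the unit "vertical" direction and
  phi is a Lipschitz function depending only on the component orthogonal to e.\<close>
definition lipschitz_domain :: "('a::euclidean_space) set \<Rightarrow> bool" where
  "lipschitz_domain \<Omega> \<longleftrightarrow>
     (\<forall>x0 \<in> frontier \<Omega>. \<exists>r > 0. \<exists>e :: 'a. \<exists>\<phi> :: 'a \<Rightarrow> real. \<exists>L.
        norm e = 1 \<and> L-lipschitz_on UNIV \<phi> \<and>
        (\<forall>z t. \<phi> (z + t *\<^sub>R e) = \<phi> z) \<and>
        \<Omega> \<inter> ball x0 r = {x \<in> ball x0 r. x \<bullet> e > \<phi> x})"

definition W_space ::
  "(real^'n \<Rightarrow> real^'n \<Rightarrow> real) \<Rightarrow> (real^'n \<Rightarrow> real^'n \<Rightarrow> real) \<Rightarrow> (real^'n) set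
     \<Rightarrow> (real^'n \<Rightarrow> real) set" where
  "W_space s p \<Omega> = {v. v \<in> borel_measurable lebesgue \<and>
      (\<integral>\<^sup>+ x. indicator \<Omega> x * ennreal (\<bar>v x\<bar> powr inf_on p \<Omega>) \<partial>lebesgue) < \<infinity> \<and>
      (\<integral>\<^sup>+ z. indicator (C_set \<Omega>) z *
          ennreal (\<bar>v (fst z) - v (snd z)\<bar> powr p (fst z) (snd z) /
                   norm (fst z - snd z) powr (real CARD('n) + s (fst z) (snd z) * p (fst z) (snd z)))
        \<partial>(lebesgue :: ((real^'n) \<times> (real^'n)) measure)) < \<infinity>}"

definition tail_space ::
  "(real^'n \<Rightarrow> real^'n \<Rightarrow> real) \<Rightarrow> (real^'n \<Rightarrow> real^'n \<Rightarrow> real) \<Rightarrow> (real^'n) set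
     \<Rightarrow> (real^'n \<Rightarrow> real) set" where
  "tail_space s p \<Omega> = {v. v \<in> borel_measurable lebesgue \<and>
      (\<exists>C::real. AE x in lebesgue. x \<in> \<Omega> \<longrightarrow>
         (\<integral>\<^sup>+ y. ennreal (\<bar>v y\<bar> powr (p x y - 1) /
                  (1 + norm y) powr (real CARD('n) + s x y * p x y)) \<partial>lebesgue) \<le> ennreal C)}"

definition energy ::
  "(real^'n \<Rightarrow> real^'n \<Rightarrow> real) \<Rightarrow> (real^'n \<Rightarrow> real^'n \<Rightarrow> real) \<Rightarrow> (real^'n) set
     \<Rightarrow> (real^'n \<Rightarrow> real) \<Rightarrow> ennreal" where
  "energy p K \<Omega> v = (\<integral>\<^sup>+ z. indicator (C_set \<Omega>) z *
      ennreal (1 / p (fst z) (snd z) * \<bar>v (fst z) - v (snd z)\<bar> powr p (fst z) (snd z)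
               * K (fst z) (snd z))
      \<partial>(lebesgue :: ((real^'n) \<times> (real^'n)) measure))"

definition standing_assumptions ::
  "(real^'n \<Rightarrow> real^'n \<Rightarrow> real) \<Rightarrow> (real^'n \<Rightarrow> real^'n \<Rightarrow> real)
     \<Rightarrow> (real^'n \<Rightarrow> real^'n \<Rightarrow> real) \<Rightarrow> bool" where
  "standing_assumptions s p K \<longleftrightarrow>
     (\<forall>x y. s x y = s y x) \<and> (\<forall>x y. p x y = p y x) \<and>
     (\<lambda>z. s (fst z) (snd z)) \<in> borel_measurable (lebesgue :: ((real^'n) \<times> (real^'n)) measure) \<and>
     (\<lambda>z. p (fst z) (snd z)) \<in> borel_measurable (lebesgue :: ((real^'n) \<times> (real^'n)) measure) \<and>
     bdd_below (range (\<lambda>(x, y). s x y)) \<and> bdd_above (range (\<lambda>(x, y). s x y)) \<and>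
     bdd_below (range (\<lambda>(x, y). p x y)) \<and> bdd_above (range (\<lambda>(x, y). p x y)) \<and>
     0 < inf_fun s \<and> sup_fun s < 1 \<and> 1 < inf_fun p \<and>
     (\<lambda>z. K (fst z) (snd z)) \<in> borel_measurable (lebesgue :: ((real^'n) \<times> (real^'n)) measure) \<and>
     (\<forall>x y. K x y = K y x) \<and>
     (\<exists>\<Lambda>>1. AE z in (lebesgue :: ((real^'n) \<times> (real^'n)) measure).
        (1 / \<Lambda>) / norm (fst z - snd z) powr (real CARD('n) + s (fst z) (snd z) * p (fst z) (snd z))
          \<le> K (fst z) (snd z) \<and>
        K (fst z) (snd z) \<le>
          \<Lambda> / norm (fst z - snd z) powr (real CARD('n) + s (fst z) (snd z) * p (fst z) (snd z)))"

end

theory Submission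
  imports Defs
begin

text \<open>Uniform convexity replaces compactness. For exponents in a compact subinterval of
  \<open>(1, \<infinity>)\<close> the number \<open>\<bar>x - y\<bar>\<close> is bounded by a multiple of the midpoint convexity gap of
  \<open>\<bar>\<cdot>\<bar> powr p\<close> plus a small multiple of \<open>1 + \<bar>x\<bar> powr p + \<bar>y\<bar> powr p\<close>. Hence almost minimal
  competitors have increments that are close in \<open>L\<^sup>1\<close> on \<open>\<Omega> \<times> A\<close>, where \<open>A\<close> is a ball away from
  \<open>\<Omega>\<close> on which all competitors coincide, and are therefore close in \<open>L\<^sup>1(\<Omega>)\<close>. A fast minimizing
  sequence converges almost everywhere, Fatou's lemma gives the minimizer, and the same estimate
  gives uniqueness.

  For the tail, \<open>h = u - g\<close> vanishes off \<open>\<Omega>\<close> and has finite Gagliardo energy. Comparing the level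
  sets of \<open>h\<close> at heights \<open>t\<close> and \<open>2t\<close> gives
  \<open>|{\<bar>h\<bar> > 2t}| \<le> C t powr (- p\<^sup>-) |{\<bar>h\<bar> > t}| powr (s\<^sup>- p\<^sup>- / n)\<close>, which iterates to the subcritical
  integrability \<open>h \<in> L\<^sup>q(\<Omega>)\<close> with \<open>q = p\<^sup>+ - 1\<close>.\<close>

section \<open>Uniform convexity of powers\<close>

text \<open>The exponent is only a measurable function, so every estimate is made on the modular
  \<integral> |f|^p and never on a norm. Minimality enters through midpoints: the midpoint of two
  competitors is again a competitor, so if both energies are at most I + \<delta> and the infimum is
  I, the integrated convexity gap is at most \<delta>. The constant 1 in the remaining error
  \<epsilon> (1 + |x|^p + |y|^p) is integrable only over a set of finite measure; this forces the
  comparison onto a test region \<Omega> \<times> A fixed in advance. In the tail part, a function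
  vanishing off \<Omega> has all its increments inside \<open>C_set \<Omega>\<close>, so balls
  around points of \<Omega> may leave \<Omega>. Variable exponents are replaced by their infima in
  the favourable direction only at heights t \<ge> 1 and distances at most 1. Hence the level set
  recursion starts late, once the level sets are small enough for the balls involved to have radius
  at most 1.\<close>

lemma powr_midpoint_less:
  fixes x y p :: real
  assumes "0 \<le> x" "x < y" "1 < p"
  shows "((x + y) / 2) powr p < (x powr p + y powr p) / 2"
proof -
  let ?m = "(x + y) / 2"
  have cont: "continuous_on {c..d} (\<lambda>t. t powr p)" if "0 \<le> c" for c d
    using that assms by (intro continuous_on_powr' continuous_intros) auto
  have der: "((\<lambda>t. t powr p) has_real_derivative p * t powr (p - 1)) (at t)" if "0 < t" for t
    using has_real_derivative_powr[OF that] by simp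
  \<comment> \<open>The mean value theorem on the two halves of [x, y] reduces strict convexity to
    strict growth of the derivative. At the left end only continuity is asked for, because x = 0 is
    allowed.\<close>
  have mvt: "\<exists>z. c < z \<and> z < d \<and> d powr p - c powr p = (d - c) * (p * z powr (p - 1))"
    if "0 \<le> c" "c < d" for c d
  proof -
    have "(\<lambda>t. t powr p) differentiable (at t)" if "c < t" "t < d" for t
      using der[of t] that \<open>0 \<le> c\<close> by (auto simp: real_differentiable_def)
    from MVT[OF \<open>c < d\<close> cont[OF \<open>0 \<le> c\<close>] this]
    obtain l z where z: "c < z" "z < d" "((\<lambda>t. t powr p) has_real_derivative l) (at z)"
        "d powr p - c powr p = (d - c) * l"
      by blast
    have "l = p * z powr (p - 1)"
      using DERIV_unique[OF z(3) der[of z]] z(1) \<open>0 \<le> c\<close> by simp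
    with z show ?thesis by blast
  qed
  obtain \<eta> where \<eta>: "x < \<eta>" "\<eta> < ?m" "?m powr p - x powr p = (?m - x) * (p * \<eta> powr (p - 1))"
    using mvt[of x ?m] assms by auto
  obtain \<xi> where \<xi>: "?m < \<xi>" "\<xi> < y" "y powr p - ?m powr p = (y - ?m) * (p * \<xi> powr (p - 1))"
    using mvt[of ?m y] assms by auto
  have "\<eta> powr (p - 1) < \<xi> powr (p - 1)"
    using \<eta> \<xi> assms by (intro powr_less_mono2) auto
  then have "(y - x) / 2 * (p * \<eta> powr (p - 1)) < (y - x) / 2 * (p * \<xi> powr (p - 1))"
    using assms by (intro mult_strict_left_mono) auto
  moreover have h: "?m - x = (y - x) / 2" "y - ?m = (y - x) / 2" by (auto simp: field_simps)
  ultimately have "?m powr p - x powr p < y powr p - ?m powr p"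
    using \<eta>(3) \<xi>(3) unfolding h by linarith
  moreover have "u < (v + w) / 2" if "u - v < w - u" for u v w :: real
    using that by (simp add: field_simps)
  ultimately show ?thesis by blast
qed

lemma abs_powr_midpoint_less:
  fixes x y p :: real
  assumes "x \<noteq> y" "1 < p"
  shows "\<bar>(x + y) / 2\<bar> powr p < (\<bar>x\<bar> powr p + \<bar>y\<bar> powr p) / 2"
proof (cases "\<bar>x\<bar> = \<bar>y\<bar>")
  case True
  then have "y = - x" "x \<noteq> 0" using assms by auto
  then show ?thesis by simp
next
  case False
  have "\<bar>(x + y) / 2\<bar> powr p \<le> ((\<bar>x\<bar> + \<bar>y\<bar>) / 2) powr p"
    using assms by (intro powr_mono2) auto
  also have "\<dots> < (\<bar>x\<bar> powr p + \<bar>y\<bar> powr p) / 2"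
    using powr_midpoint_less[of "\<bar>x\<bar>" "\<bar>y\<bar>" p] powr_midpoint_less[of "\<bar>y\<bar>" "\<bar>x\<bar>" p] False assms
    by (cases "\<bar>x\<bar> < \<bar>y\<bar>") (auto simp: add.commute)
  finally show ?thesis .
qed

lemma abs_powr_midpoint_le:
  fixes x y p :: real
  assumes "1 < p"
  shows "\<bar>(x + y) / 2\<bar> powr p \<le> (\<bar>x\<bar> powr p + \<bar>y\<bar> powr p) / 2"
  using abs_powr_midpoint_less[of x y p] assms by (cases "x = y") auto

text \<open>The inequality can fail without the gap term only if |x - y| exceeds \<epsilon> (1 +
  |x|^p + |y|^p). Superlinear growth, uniform because p \<ge> a > 1, then confines x and y to a
  fixed box, and |x - y| \<ge> \<epsilon> there. On this compact set of triples (p, x, y) the gap is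
  continuous and positive, hence bounded below, with a constant independent of p.\<close>

lemma abs_diff_le_midpoint_gap:
  fixes a b \<epsilon> :: real
  assumes "1 < a" "0 < \<epsilon>"
  obtains C where "0 \<le> C" and
    "\<And>p x y. a \<le> p \<Longrightarrow> p \<le> b \<Longrightarrow>
       \<bar>x - y\<bar> \<le> C * ((\<bar>x\<bar> powr p + \<bar>y\<bar> powr p) / 2 - \<bar>(x + y) / 2\<bar> powr p)
                 + \<epsilon> * (1 + \<bar>x\<bar> powr p + \<bar>y\<bar> powr p)"
proof -
  define M where "M = max 1 ((2 / \<epsilon>) powr (1 / (a - 1)))"
  define gap where "gap = (\<lambda>(p, x, y). (\<bar>x\<bar> powr p + \<bar>y\<bar> powr p) / 2 - \<bar>(x + y) / 2 :: real\<bar> powr p)"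
  define S where "S = ({a..b} \<times> {-M..M} \<times> {-M..M}) \<inter> {z. \<epsilon> \<le> \<bar>fst (snd z) - snd (snd z)\<bar>}"
  have bound: "\<bar>x\<bar> \<le> M \<and> \<bar>y\<bar> \<le> M"
    if "a \<le> p" and big: "\<epsilon> * (1 + \<bar>x\<bar> powr p + \<bar>y\<bar> powr p) < \<bar>x - y\<bar>" for p x y
  proof -
    define m where "m = max \<bar>x\<bar> \<bar>y\<bar>"
    have "m \<le> M"
    proof (cases "m \<le> 1")
      case False
      have "m powr a \<le> m powr p" using False that by (intro powr_mono) auto
      also have "\<dots> \<le> \<bar>x\<bar> powr p + \<bar>y\<bar> powr p" by (auto simp: m_def max_def)
      finally have "\<epsilon> * m powr a \<le> \<epsilon> * (1 + \<bar>x\<bar> powr p + \<bar>y\<bar> powr p)"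
        using assms by (intro mult_left_mono) auto
      also have "\<dots> < 2 * m" using big by (auto simp: m_def)
      finally have "\<epsilon> * (m * m powr (a - 1)) < 2 * m"
        using False by (simp add: powr_mult_base)
      then have "m powr (a - 1) < 2 / \<epsilon>" using False assms by (simp add: field_simps)
      then have "(m powr (a - 1)) powr (1 / (a - 1)) < (2 / \<epsilon>) powr (1 / (a - 1))"
        using assms by (intro powr_less_mono2) auto
      then have "m < (2 / \<epsilon>) powr (1 / (a - 1))" using False assms by (simp add: powr_powr)
      then show ?thesis by (auto simp: M_def)
    qed (auto simp: M_def)
    then show ?thesis by (auto simp: m_def)
  qed
  have "\<exists>c>0. \<forall>z\<in>S. c \<le> gap z"
  proof (cases "S = {}")
    case False
    have "closed {z::real \<times> real \<times> real. \<epsilon> \<le> \<bar>fst (snd z) - snd (snd z)\<bar>}"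
      by (intro closed_Collect_le continuous_intros)
    then have "compact S" unfolding S_def
      by (intro compact_Int_closed compact_Times compact_Icc)
    moreover have "continuous_on S gap"
      unfolding gap_def case_prod_beta using assms(1)
      by (intro continuous_intros continuous_on_powr') (auto simp: S_def)
    ultimately obtain z0 where z0: "z0 \<in> S" "\<forall>z\<in>S. gap z0 \<le> gap z"
      using continuous_attains_inf[of S gap] False by blast
    have "0 < gap z0"
    proof -
      obtain p x y where "z0 = (p, x, y)" by (cases z0)
      then show ?thesis
        using z0(1) abs_powr_midpoint_less[of x y p] assms by (auto simp: S_def gap_def)
    qed
    with z0 show ?thesis by blast
  qed (auto intro: exI[of _ 1])
  then obtain c where c: "c > 0" "\<And>z. z \<in> S \<Longrightarrow> c \<le> gap z" by blast
  show thesis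
  proof
    \<comment> \<open>On \<open>S\<close> the left side is at most 2 M while the gap is at least c,
      so the factor 2 M / c suffices.\<close>
    show "0 \<le> 2 * M / c" using c by (auto simp: M_def)
    fix p x y :: real assume p: "a \<le> p" "p \<le> b"
    have gap0: "0 \<le> gap (p, x, y)"
      using abs_powr_midpoint_le[of p x y] assms p by (auto simp: gap_def)
    have "\<bar>x - y\<bar> \<le> 2 * M / c * gap (p, x, y) + \<epsilon> * (1 + \<bar>x\<bar> powr p + \<bar>y\<bar> powr p)"
    proof (cases "\<bar>x - y\<bar> \<le> \<epsilon> * (1 + \<bar>x\<bar> powr p + \<bar>y\<bar> powr p)")
      case True
      moreover have "0 \<le> 2 * M / c * gap (p, x, y)" using gap0 c by (simp add: M_def)
      ultimately show ?thesis by linarith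
    next
      case False
      then have *: "\<bar>x\<bar> \<le> M" "\<bar>y\<bar> \<le> M" using bound[OF p(1), of x y] by (auto simp: not_le)
      have "\<epsilon> \<le> \<epsilon> * (1 + \<bar>x\<bar> powr p + \<bar>y\<bar> powr p)" using assms by (simp add: algebra_simps)
      then have "(p, x, y) \<in> S" using False * p by (auto simp: S_def)
      then have "2 * M * 1 \<le> 2 * M * (gap (p, x, y) / c)"
        using c by (intro mult_left_mono) (auto simp: M_def)
      moreover have "\<bar>x - y\<bar> \<le> 2 * M" using * by auto
      moreover have "0 \<le> \<epsilon> * (1 + \<bar>x\<bar> powr p + \<bar>y\<bar> powr p)" using assms by simp
      ultimately show ?thesis by simp
    qed
    then show "\<bar>x - y\<bar> \<le> 2 * M / c * ((\<bar>x\<bar> powr p + \<bar>y\<bar> powr p) / 2 - \<bar>(x + y) / 2\<bar> powr p)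
                 + \<epsilon> * (1 + \<bar>x\<bar> powr p + \<bar>y\<bar> powr p)"
      by (simp add: gap_def)
  qed
qed

lemma near_minimizers_L1_close:
  fixes \<nu> :: "'z measure" and p :: "'z \<Rightarrow> real"
  assumes p[measurable]: "p \<in> borel_measurable \<nu>" and pab: "\<And>z. a \<le> p z" "\<And>z. p z \<le> b" "1 < a"
    and B[measurable]: "B \<in> sets \<nu>" "emeasure \<nu> B < \<infinity>" and "0 < \<eta>" "0 \<le> I"
  obtains \<delta> where "0 < \<delta>" and
    "\<And>f h. f \<in> borel_measurable \<nu> \<Longrightarrow> h \<in> borel_measurable \<nu> \<Longrightarrow>
       (\<integral>\<^sup>+z. ennreal (\<bar>f z\<bar> powr p z) \<partial>\<nu>) \<le> ennreal (I + \<delta>) \<Longrightarrow>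
       (\<integral>\<^sup>+z. ennreal (\<bar>h z\<bar> powr p z) \<partial>\<nu>) \<le> ennreal (I + \<delta>) \<Longrightarrow>
       ennreal I \<le> (\<integral>\<^sup>+z. ennreal (\<bar>(f z + h z) / 2\<bar> powr p z) \<partial>\<nu>) \<Longrightarrow>
       (\<integral>\<^sup>+z. indicator B z * ennreal \<bar>f z - h z\<bar> \<partial>\<nu>) \<le> ennreal \<eta>"
proof -
  define m where "m = measure \<nu> B"
  have m: "emeasure \<nu> B = ennreal m" "0 \<le> m"
    using B by (auto simp: m_def emeasure_eq_ennreal_measure)
  \<comment> \<open>Integration leaves the error C \<delta> + \<epsilon> (m + 2 I + 2 \<delta>).
    With \<delta> \<le> 1 this \<epsilon> makes the second term at most \<eta> / 2. Since C depends
    on \<epsilon>, \<delta> is chosen afterwards to do the same for the first.\<close>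
  define \<epsilon> where "\<epsilon> = \<eta> / (2 * (m + 2 * I + 2))"
  have "0 < \<epsilon>" using assms m by (auto simp: \<epsilon>_def)
  obtain C where C: "0 \<le> C" "\<And>p x y. a \<le> p \<Longrightarrow> p \<le> b \<Longrightarrow>
       \<bar>x - y\<bar> \<le> C * ((\<bar>x\<bar> powr p + \<bar>y\<bar> powr p) / 2 - \<bar>(x + y) / 2\<bar> powr p)
                 + \<epsilon> * (1 + \<bar>x\<bar> powr p + \<bar>y\<bar> powr p)"
    using abs_diff_le_midpoint_gap[OF \<open>1 < a\<close> \<open>0 < \<epsilon>\<close>, of b] by blast
  define \<delta> where "\<delta> = min 1 (\<eta> / (2 * (C + 1)))"
  have \<delta>: "0 < \<delta>" "\<delta> \<le> 1" "C * \<delta> \<le> \<eta> / 2"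
  proof -
    show "0 < \<delta>" "\<delta> \<le> 1" using assms C by (auto simp: \<delta>_def)
    have "C * \<delta> \<le> (C + 1) * (\<eta> / (2 * (C + 1)))"
      using C assms by (intro mult_mono) (auto simp: \<delta>_def)
    also have "\<dots> = \<eta> / 2" using C(1) by (simp add: field_simps)
    finally show "C * \<delta> \<le> \<eta> / 2" .
  qed
  show thesis
  proof (rule that[OF \<delta>(1)])
    fix f h assume [measurable]: "f \<in> borel_measurable \<nu>" "h \<in> borel_measurable \<nu>"
      and fI: "(\<integral>\<^sup>+z. ennreal (\<bar>f z\<bar> powr p z) \<partial>\<nu>) \<le> ennreal (I + \<delta>)"
      and hI: "(\<integral>\<^sup>+z. ennreal (\<bar>h z\<bar> powr p z) \<partial>\<nu>) \<le> ennreal (I + \<delta>)"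
      and mI: "ennreal I \<le> (\<integral>\<^sup>+z. ennreal (\<bar>(f z + h z) / 2\<bar> powr p z) \<partial>\<nu>)"
    let ?X = "\<integral>\<^sup>+z. indicator B z * ennreal \<bar>f z - h z\<bar> \<partial>\<nu>"
    \<comment> \<open>The midpoint term stands on the left, so that nothing is subtracted in
      \<open>ennreal\<close>; C I is cancelled only after passing to reals. The constant 1 is
      charged on B alone, and off B plain midpoint convexity is enough.\<close>
    have pw: "indicator B z * ennreal \<bar>f z - h z\<bar> + ennreal C * ennreal (\<bar>(f z + h z) / 2\<bar> powr p z)
       \<le> ennreal (C / 2 + \<epsilon>) * (ennreal (\<bar>f z\<bar> powr p z) + ennreal (\<bar>h z\<bar> powr p z))
          + ennreal \<epsilon> * indicator B z" for z
    proof -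
      let ?F = "\<bar>f z\<bar> powr p z" and ?H = "\<bar>h z\<bar> powr p z" and ?M = "\<bar>(f z + h z) / 2\<bar> powr p z"
      have "C * ?M \<le> C * ((?F + ?H) / 2)"
        using C pab(3) pab(1)[of z] by (intro mult_left_mono abs_powr_midpoint_le) auto
      moreover have "0 \<le> \<epsilon> * (?F + ?H)" using \<open>0 < \<epsilon>\<close> by simp
      moreover have "C * M \<le> (C / 2 + \<epsilon>) * (F + H)"
        if "C * M \<le> C * ((F + H) / 2)" "0 \<le> \<epsilon> * (F + H)" for F H M
        using that by (simp add: field_simps)
      moreover have "d + C * M \<le> (C / 2 + \<epsilon>) * (F + H) + \<epsilon>"
        if "d \<le> C * ((F + H) / 2 - M) + \<epsilon> * (1 + F + H)" for d F H M
        using that by (simp add: field_simps)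
      ultimately have "indicator B z * \<bar>f z - h z\<bar> + C * ?M \<le> (C / 2 + \<epsilon>) * (?F + ?H) + \<epsilon> * indicator B z"
        using C(2)[OF pab(1)[of z] pab(2)[of z], of "f z" "h z"]
        by (cases "z \<in> B") simp_all
      then have "ennreal (indicator B z * \<bar>f z - h z\<bar> + C * ?M)
          \<le> ennreal ((C / 2 + \<epsilon>) * (?F + ?H) + \<epsilon> * indicator B z)"
        by (rule ennreal_leI)
      then show ?thesis
        using C \<open>0 < \<epsilon>\<close> by (simp add: ennreal_plus ennreal_mult ennreal_indicator del: ennreal_plus[symmetric])
    qed
    have "?X + ennreal (C * I) \<le> ?X + ennreal C * (\<integral>\<^sup>+z. ennreal (\<bar>(f z + h z) / 2\<bar> powr p z) \<partial>\<nu>)"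
      using mI C \<open>0 \<le> I\<close> by (auto simp: ennreal_mult intro!: add_mono mult_mono)
    also have "\<dots> = (\<integral>\<^sup>+z. indicator B z * ennreal \<bar>f z - h z\<bar>
                        + ennreal C * ennreal (\<bar>(f z + h z) / 2\<bar> powr p z) \<partial>\<nu>)"
      by (simp add: nn_integral_add nn_integral_cmult)
    also have "\<dots> \<le> (\<integral>\<^sup>+z. ennreal (C / 2 + \<epsilon>) * (ennreal (\<bar>f z\<bar> powr p z) + ennreal (\<bar>h z\<bar> powr p z))
          + ennreal \<epsilon> * indicator B z \<partial>\<nu>)"
      by (intro nn_integral_mono pw)
    also have "\<dots> = ennreal (C / 2 + \<epsilon>) * ((\<integral>\<^sup>+z. ennreal (\<bar>f z\<bar> powr p z) \<partial>\<nu>)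
          + (\<integral>\<^sup>+z. ennreal (\<bar>h z\<bar> powr p z) \<partial>\<nu>)) + ennreal \<epsilon> * emeasure \<nu> B"
      by (simp add: nn_integral_add nn_integral_cmult)
    also have "\<dots> \<le> ennreal (C / 2 + \<epsilon>) * (ennreal (I + \<delta>) + ennreal (I + \<delta>)) + ennreal \<epsilon> * ennreal m"
      unfolding m by (intro add_mono mult_left_mono fI hI) auto
    also have "\<dots> = ennreal ((C / 2 + \<epsilon>) * ((I + \<delta>) + (I + \<delta>)) + \<epsilon> * m)"
    proof -
      have "ennreal c * (ennreal d + ennreal d) + ennreal e * ennreal k = ennreal (c * (d + d) + e * k)"
        if "0 \<le> c" "0 \<le> d" "0 \<le> e" "0 \<le> k" for c d e k
        using that by (simp only: ennreal_mult ennreal_plus add_nonneg_nonneg mult_nonneg_nonneg)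
      note * = this
      show ?thesis using C(1) \<open>0 < \<epsilon>\<close> \<delta>(1) \<open>0 \<le> I\<close> m(2) by (intro *) auto
    qed
    finally have le: "?X + ennreal (C * I) \<le> ennreal ((C / 2 + \<epsilon>) * ((I + \<delta>) + (I + \<delta>)) + \<epsilon> * m)" .
    show "?X \<le> ennreal \<eta>"
    proof (cases ?X)
      case (real x)
      then have "x + C * I \<le> (C / 2 + \<epsilon>) * ((I + \<delta>) + (I + \<delta>)) + \<epsilon> * m"
        using le C \<open>0 \<le> I\<close> \<open>0 < \<epsilon>\<close> \<delta> m by (simp flip: ennreal_plus)
      then have "x \<le> C * \<delta> + \<epsilon> * (m + 2 * I + 2 * \<delta>)" by (simp add: algebra_simps)
      also have "\<dots> \<le> \<eta> / 2 + \<epsilon> * (m + 2 * I + 2)"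
        using \<delta> \<open>0 < \<epsilon>\<close> by (intro add_mono mult_left_mono) auto
      also have "\<epsilon> * (m + 2 * I + 2) = \<eta> / 2"
        using m \<open>0 \<le> I\<close> by (simp add: \<epsilon>_def field_simps)
      finally have "x \<le> \<eta>" by simp
      then show ?thesis using real by (simp add: ennreal_leI)
    next
      case top
      then show ?thesis using le by (simp add: top_unique)
    qed
  qed
qed

section \<open>Lebesgue measure on products\<close>

text \<open>The measure \<open>lebesgue\<close> on the product is the completion of a product, not a
  product of completions, so Fubini is applied to a Borel null set N containing the exceptional
  points: N \<times> UNIV has null sections.\<close>

lemma AE_lebesgue_fst:
  fixes P :: "'a::euclidean_space \<Rightarrow> bool"
  assumes "AE x in lebesgue. P x"
  shows "AE z in (lebesgue :: ('a \<times> 'b::euclidean_space) measure). P (fst z)"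
proof -
  obtain N where N: "N \<in> null_sets lborel" "{x. \<not> P x} \<subseteq> N"
    using assms unfolding AE_completion_iff by (auto simp: eventually_ae_filter)
  have [measurable]: "N \<in> sets lborel" using N by auto
  have "AE x in lborel. AE y in lborel. fst (x, y :: 'b) \<notin> N"
    using AE_not_in[OF N(1)] by (auto elim!: eventually_mono)
  then have "AE z in lborel \<Otimes>\<^sub>M lborel. fst (z :: 'a \<times> 'b) \<notin> N"
    by (intro lborel_pair.AE_pair_measure) measurable
  then have "AE z in lborel. fst (z :: 'a \<times> 'b) \<notin> N" unfolding lborel_prod .
  then show ?thesis using N(2) by (auto simp: AE_completion_iff elim!: eventually_mono)
qed

lemma AE_lebesgue_snd:
  fixes P :: "'b::euclidean_space \<Rightarrow> bool"
  assumes "AE x in lebesgue. P x"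
  shows "AE z in (lebesgue :: ('a::euclidean_space \<times> 'b) measure). P (snd z)"
proof -
  obtain N where N: "N \<in> null_sets lborel" "{x. \<not> P x} \<subseteq> N"
    using assms unfolding AE_completion_iff by (auto simp: eventually_ae_filter)
  have [measurable]: "N \<in> sets lborel" using N by auto
  have "AE x in lborel. AE y in lborel. snd (x :: 'a, y) \<notin> N"
    using AE_not_in[OF N(1)] by (auto elim!: eventually_mono)
  then have "AE z in lborel \<Otimes>\<^sub>M lborel. snd (z :: 'a \<times> 'b) \<notin> N"
    by (intro lborel_pair.AE_pair_measure) measurable
  then have "AE z in lborel. snd (z :: 'a \<times> 'b) \<notin> N" unfolding lborel_prod .
  then show ?thesis using N(2) by (auto simp: AE_completion_iff elim!: eventually_mono)
qed

lemma lebesgue_borel_representative: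
  fixes v :: "'a::euclidean_space \<Rightarrow> real"
  assumes "v \<in> borel_measurable lebesgue"
  obtains v' where "v' \<in> borel_measurable borel" "AE x in lebesgue. v x = v' x"
  using completion_ex_borel_measurable_real[OF assms] by (auto simp: AE_completion_iff)

lemma borel_fst_snd:
  "(fst :: 'a::euclidean_space \<times> 'b::euclidean_space \<Rightarrow> 'a) \<in> borel_measurable borel"
  "(snd :: 'a::euclidean_space \<times> 'b::euclidean_space \<Rightarrow> 'b) \<in> borel_measurable borel"
  by (auto intro!: borel_measurable_continuous_onI continuous_intros)

lemma lebesgue_measurable_borel:
  fixes f :: "'a::euclidean_space \<Rightarrow> 'b::topological_space"
  shows "f \<in> borel_measurable borel \<Longrightarrow> f \<in> borel_measurable lebesgue"
  by (intro measurable_completion) simp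

text \<open>A Borel representative composes with the continuous projection, and the null set where
  it differs from \<open>v\<close> pulls back to a null set.\<close>

lemma lebesgue_measurable_fst:
  fixes v :: "'a::euclidean_space \<Rightarrow> real"
  assumes "v \<in> borel_measurable lebesgue"
  shows "(\<lambda>z. v (fst z)) \<in> borel_measurable (lebesgue :: ('a \<times> 'b::euclidean_space) measure)"
proof -
  obtain v' where v': "v' \<in> borel_measurable borel" "AE x in lebesgue. v x = v' x"
    using lebesgue_borel_representative[OF assms] .
  have "(\<lambda>z. v' (fst z)) \<in> borel_measurable (lebesgue :: ('a \<times> 'b) measure)"
    using measurable_compose[OF borel_fst_snd(1) v'(1)] by (rule lebesgue_measurable_borel)
  moreover have "AE z in (lebesgue :: ('a \<times> 'b) measure). v' (fst z) = v (fst z)"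
    using AE_lebesgue_fst[OF v'(2)] by (auto elim!: eventually_mono)
  ultimately show ?thesis by (rule borel_measurable_AE)
qed

lemma lebesgue_measurable_snd:
  fixes v :: "'b::euclidean_space \<Rightarrow> real"
  assumes "v \<in> borel_measurable lebesgue"
  shows "(\<lambda>z. v (snd z)) \<in> borel_measurable (lebesgue :: ('a::euclidean_space \<times> 'b) measure)"
proof -
  obtain v' where v': "v' \<in> borel_measurable borel" "AE x in lebesgue. v x = v' x"
    using lebesgue_borel_representative[OF assms] .
  have "(\<lambda>z. v' (snd z)) \<in> borel_measurable (lebesgue :: ('a \<times> 'b) measure)"
    using measurable_compose[OF borel_fst_snd(2) v'(1)] by (rule lebesgue_measurable_borel)
  moreover have "AE z in (lebesgue :: ('a \<times> 'b) measure). v' (snd z) = v (snd z)"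
    using AE_lebesgue_snd[OF v'(2)] by (auto elim!: eventually_mono)
  ultimately show ?thesis by (rule borel_measurable_AE)
qed

lemma AE_lebesgue_pair:
  fixes P :: "'a::euclidean_space \<times> 'b::euclidean_space \<Rightarrow> bool"
  assumes "AE z in lebesgue. P z"
  shows "AE x in lebesgue. AE y in lebesgue. P (x, y)"
proof -
  have "AE z in lborel \<Otimes>\<^sub>M lborel. P z"
    using assms unfolding AE_completion_iff lborel_prod .
  from lborel_pair.AE_pair[OF this] show ?thesis by (simp add: AE_completion_iff)
qed

text \<open>Sections of a null set are null only for almost every x, and so the conclusion holds
  only for such x. This fits the essential supremum in \<open>tail_space\<close>.\<close>

lemma lebesgue_measurable_slice:
  fixes f :: "'a::euclidean_space \<times> 'b::euclidean_space \<Rightarrow> real"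
  assumes "f \<in> borel_measurable lebesgue"
  shows "AE x in lebesgue. (\<lambda>y. f (x, y)) \<in> borel_measurable lebesgue"
proof -
  obtain f' where f': "f' \<in> borel_measurable borel" "AE z in lebesgue. f z = f' z"
    using lebesgue_borel_representative[OF assms] .
  have "(\<lambda>y. (x, y)) \<in> borel_measurable borel" for x :: 'a
    by (intro borel_measurable_continuous_onI continuous_intros)
  from measurable_compose[OF this f'(1)]
  have slice: "(\<lambda>y. f' (x, y)) \<in> borel_measurable lebesgue" for x
    by (rule lebesgue_measurable_borel)
  show ?thesis
    using AE_lebesgue_pair[OF f'(2)]
  proof eventually_elim
    case (elim x)
    then have "AE y in lebesgue. f' (x, y) = f (x, y)" by (auto elim!: eventually_mono)
    with slice show ?case by (rule borel_measurable_AE)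
  qed
qed

lemma nn_integral_lebesgue_pair:
  fixes f :: "'a::euclidean_space \<times> 'b::euclidean_space \<Rightarrow> ennreal"
  assumes "f \<in> borel_measurable borel"
  shows "(\<integral>\<^sup>+z. f z \<partial>lebesgue) = (\<integral>\<^sup>+x. \<integral>\<^sup>+y. f (x, y) \<partial>lebesgue \<partial>lebesgue)"
  using lborel.nn_integral_fst[of f lborel] assms by (simp add: nn_integral_completion lborel_prod)

section \<open>The energy space\<close>

lemma abs_add_powr_le:
  fixes x y r :: real
  assumes "0 \<le> r"
  shows "\<bar>x + y\<bar> powr r \<le> 2 powr r * (\<bar>x\<bar> powr r + \<bar>y\<bar> powr r)"
proof -
  have "\<bar>x + y\<bar> powr r \<le> (2 * max \<bar>x\<bar> \<bar>y\<bar>) powr r"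
    using assms by (intro powr_mono2) auto
  also have "\<dots> = 2 powr r * (max \<bar>x\<bar> \<bar>y\<bar>) powr r"
    by (simp add: powr_mult)
  also have "\<dots> \<le> 2 powr r * (\<bar>x\<bar> powr r + \<bar>y\<bar> powr r)"
    by (intro mult_left_mono) (auto simp: max_def)
  finally show ?thesis .
qed

lemma powr_le_one_plus_powr:
  fixes t q r :: real
  assumes "0 \<le> t" "0 \<le> q" "q \<le> r"
  shows "t powr q \<le> 1 + t powr r"
proof (cases "t \<le> 1")
  case True
  then have "t powr q \<le> 1" using powr_mono2[of q t 1] assms by simp
  then show ?thesis by (simp add: add_increasing2)
next
  case False
  then have "t powr q \<le> t powr r" using assms by (intro powr_mono) auto
  then show ?thesis by simp
qed

section \<open>The seminorm, the energy and membership in the space\<close>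

definition gagliardo ::
  "(real^'n \<Rightarrow> real^'n \<Rightarrow> real) \<Rightarrow> (real^'n \<Rightarrow> real^'n \<Rightarrow> real) \<Rightarrow> (real^'n) set
     \<Rightarrow> (real^'n \<Rightarrow> real) \<Rightarrow> ennreal" where
  "gagliardo s p \<Omega> v = (\<integral>\<^sup>+ z. indicator (C_set \<Omega>) z *
          ennreal (\<bar>v (fst z) - v (snd z)\<bar> powr p (fst z) (snd z) /
                   norm (fst z - snd z) powr (real CARD('n) + s (fst z) (snd z) * p (fst z) (snd z)))
        \<partial>(lebesgue :: ((real^'n) \<times> (real^'n)) measure))"

locale variable_order_energy =
  fixes s p K :: "real^'n \<Rightarrow> real^'n \<Rightarrow> real" and \<Omega> :: "(real^'n) set"
  assumes S: "standing_assumptions s p K" and bounded: "bounded \<Omega>" and "open": "open \<Omega>"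
begin

lemma p_bounds: "inf_fun p \<le> p x y" "p x y \<le> sup_fun p" "1 < inf_fun p" "1 < p x y"
proof -
  have b: "bdd_below (range (\<lambda>(x, y). p x y))" "bdd_above (range (\<lambda>(x, y). p x y))" and 1: "1 < inf_fun p"
    using S by (auto simp: standing_assumptions_def)
  have m: "p x y \<in> range (\<lambda>(x, y). p x y)" by (rule image_eqI[of _ _ "(x, y)"]) auto
  show "inf_fun p \<le> p x y" "p x y \<le> sup_fun p"
    unfolding inf_fun_def sup_fun_def using b m by (auto intro: cInf_lower cSup_upper)
  with 1 show "1 < inf_fun p" "1 < p x y" by auto
qed

lemma s_bounds: "inf_fun s \<le> s x y" "s x y < 1" "0 < inf_fun s" "0 < s x y"
proof -
  have b: "bdd_below (range (\<lambda>(x, y). s x y))" "bdd_above (range (\<lambda>(x, y). s x y))"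
    and 1: "0 < inf_fun s" "sup_fun s < 1"
    using S by (auto simp: standing_assumptions_def)
  have m: "s x y \<in> range (\<lambda>(x, y). s x y)" by (rule image_eqI[of _ _ "(x, y)"]) auto
  have "inf_fun s \<le> s x y" "s x y \<le> sup_fun s"
    unfolding inf_fun_def sup_fun_def using b m by (auto intro: cInf_lower cSup_upper)
  with 1 show "inf_fun s \<le> s x y" "s x y < 1" "0 < inf_fun s" "0 < s x y" by auto
qed

lemma measurable_data [measurable]:
  "(\<lambda>z. s (fst z) (snd z)) \<in> borel_measurable (lebesgue :: ((real^'n) \<times> (real^'n)) measure)"
  "(\<lambda>z. p (fst z) (snd z)) \<in> borel_measurable (lebesgue :: ((real^'n) \<times> (real^'n)) measure)"
  "(\<lambda>z. K (fst z) (snd z)) \<in> borel_measurable (lebesgue :: ((real^'n) \<times> (real^'n)) measure)"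
  using S by (auto simp: standing_assumptions_def)

lemma measurable_norm_diff [measurable]:
  "(\<lambda>z. norm (fst z - snd z)) \<in> borel_measurable (lebesgue :: ((real^'n) \<times> (real^'n)) measure)"
  by (intro lebesgue_measurable_borel borel_measurable_continuous_onI continuous_intros)

lemma sets_\<Omega> [measurable]: "\<Omega> \<in> sets borel" "\<Omega> \<in> sets lebesgue"
  using "open" by auto

lemma sets_C_set [measurable]: "C_set \<Omega> \<in> sets borel" "C_set \<Omega> \<in> sets lebesgue"
proof -
  have "closed ((UNIV - \<Omega>) \<times> (UNIV - \<Omega>))"
    using "open" by (intro closed_Times) (auto simp: closed_def Diff_Diff_Int)
  then have "open (C_set \<Omega>)" unfolding C_set_def by (auto intro: open_Diff)
  then show "C_set \<Omega> \<in> sets borel" "C_set \<Omega> \<in> sets lebesgue" by auto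
qed

lemma kernel_bounds:
  obtains \<Lambda> where "1 < \<Lambda>"
    "AE z in (lebesgue :: ((real^'n) \<times> (real^'n)) measure).
       1 / \<Lambda> / norm (fst z - snd z) powr (real CARD('n) + s (fst z) (snd z) * p (fst z) (snd z))
          \<le> K (fst z) (snd z)"
    "AE z in (lebesgue :: ((real^'n) \<times> (real^'n)) measure). K (fst z) (snd z) \<le>
          \<Lambda> / norm (fst z - snd z) powr (real CARD('n) + s (fst z) (snd z) * p (fst z) (snd z))"
  using S by (auto simp: standing_assumptions_def)

lemma gagliardo_integrand_measurable:
  assumes "v \<in> borel_measurable lebesgue"
  shows "(\<lambda>z. ennreal (\<bar>v (fst z) - v (snd z)\<bar> powr p (fst z) (snd z) /
     norm (fst z - snd z) powr (real CARD('n) + s (fst z) (snd z) * p (fst z) (snd z))))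
     \<in> borel_measurable (lebesgue :: ((real^'n) \<times> (real^'n)) measure)"
proof -
  note [measurable] = lebesgue_measurable_fst[OF assms] lebesgue_measurable_snd[OF assms]
  show ?thesis by measurable
qed

lemma energy_integrand_measurable:
  assumes "v \<in> borel_measurable lebesgue"
  shows "(\<lambda>z. ennreal (1 / p (fst z) (snd z) * \<bar>v (fst z) - v (snd z)\<bar> powr p (fst z) (snd z)
               * K (fst z) (snd z)))
     \<in> borel_measurable (lebesgue :: ((real^'n) \<times> (real^'n)) measure)"
proof -
  note [measurable] = lebesgue_measurable_fst[OF assms] lebesgue_measurable_snd[OF assms]
  show ?thesis by measurable
qed

text \<open>The kernel bounds hold on both sides almost everywhere, and 1 / p lies between 1 /
  \<open>sup_fun p\<close> and 1, so each quantity is at most a constant times the other.\<close>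

lemma energy_finite_iff:
  assumes v: "v \<in> borel_measurable lebesgue"
  shows "energy p K \<Omega> v < \<infinity> \<longleftrightarrow> gagliardo s p \<Omega> v < \<infinity>"
proof -
  obtain \<Lambda> where \<Lambda>: "1 < \<Lambda>"
    "AE z in (lebesgue :: ((real^'n) \<times> (real^'n)) measure).
       1 / \<Lambda> / norm (fst z - snd z) powr (real CARD('n) + s (fst z) (snd z) * p (fst z) (snd z))
          \<le> K (fst z) (snd z)"
    "AE z in (lebesgue :: ((real^'n) \<times> (real^'n)) measure). K (fst z) (snd z) \<le>
          \<Lambda> / norm (fst z - snd z) powr (real CARD('n) + s (fst z) (snd z) * p (fst z) (snd z))"
    by (rule kernel_bounds)
  note [measurable] = gagliardo_integrand_measurable[OF v] energy_integrand_measurable[OF v]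
  have "energy p K \<Omega> v \<le> (\<integral>\<^sup>+ z. ennreal \<Lambda> * (indicator (C_set \<Omega>) z *
          ennreal (\<bar>v (fst z) - v (snd z)\<bar> powr p (fst z) (snd z) /
                   norm (fst z - snd z) powr (real CARD('n) + s (fst z) (snd z) * p (fst z) (snd z))))
        \<partial>lebesgue)"
    unfolding energy_def
  proof (intro nn_integral_mono_AE, use \<Lambda>(3) in eventually_elim)
    case (elim z)
    let ?p = "p (fst z) (snd z)" and ?k = "K (fst z) (snd z)"
    let ?A = "\<bar>v (fst z) - v (snd z)\<bar> powr ?p"
    let ?N = "norm (fst z - snd z) powr (real CARD('n) + s (fst z) (snd z) * ?p)"
    have "1 / ?p * ?A * ?k \<le> 1 / ?p * ?A * (\<Lambda> / ?N)"
      using elim p_bounds(4)[of "fst z" "snd z"] by (intro mult_left_mono) auto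
    also have "\<dots> \<le> 1 * ?A * (\<Lambda> / ?N)"
      using \<Lambda>(1) p_bounds(4)[of "fst z" "snd z"] by (intro mult_right_mono) auto
    finally have "ennreal (1 / ?p * ?A * ?k) \<le> ennreal (\<Lambda> * (?A / ?N))"
      by (intro ennreal_leI) (simp add: mult.commute)
    also have "\<dots> = ennreal \<Lambda> * ennreal (?A / ?N)"
      using \<Lambda>(1) by (intro ennreal_mult) auto
    finally show ?case by (auto simp: indicator_def)
  qed
  also have "\<dots> = ennreal \<Lambda> * gagliardo s p \<Omega> v"
    unfolding gagliardo_def by (intro nn_integral_cmult) measurable
  finally have 1: "energy p K \<Omega> v \<le> ennreal \<Lambda> * gagliardo s p \<Omega> v" .
  have "gagliardo s p \<Omega> v \<le> (\<integral>\<^sup>+ z. ennreal (\<Lambda> * sup_fun p) * (indicator (C_set \<Omega>) z *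
          ennreal (1 / p (fst z) (snd z) * \<bar>v (fst z) - v (snd z)\<bar> powr p (fst z) (snd z)
               * K (fst z) (snd z))) \<partial>lebesgue)"
    unfolding gagliardo_def
  proof (intro nn_integral_mono_AE, use \<Lambda>(2) in eventually_elim)
    case (elim z)
    let ?p = "p (fst z) (snd z)" and ?k = "K (fst z) (snd z)"
    let ?A = "\<bar>v (fst z) - v (snd z)\<bar> powr ?p"
    let ?N = "norm (fst z - snd z) powr (real CARD('n) + s (fst z) (snd z) * ?p)"
    have k: "0 \<le> ?k" using elim \<Lambda>(1) by (meson divide_nonneg_nonneg order_trans powr_ge_zero zero_le_one less_imp_le less_trans zero_less_one)
    have "?A / ?N = \<Lambda> * ?A * (1 / \<Lambda> / ?N)" using \<Lambda>(1) by simp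
    also have "\<dots> \<le> \<Lambda> * ?A * ?k" using elim \<Lambda>(1) by (intro mult_left_mono) auto
    also have "\<dots> = \<Lambda> * ?p * (1 / ?p * ?A * ?k)"
      using p_bounds(4)[of "fst z" "snd z"] by simp
    also have "\<dots> \<le> \<Lambda> * sup_fun p * (1 / ?p * ?A * ?k)"
      using p_bounds(2,4)[of "fst z" "snd z"] k \<Lambda>(1) by (intro mult_right_mono mult_left_mono) auto
    finally have "ennreal (?A / ?N) \<le> ennreal (\<Lambda> * sup_fun p * (1 / ?p * ?A * ?k))"
      by (rule ennreal_leI)
    also have "\<dots> = ennreal (\<Lambda> * sup_fun p) * ennreal (1 / ?p * ?A * ?k)"
      using \<Lambda>(1) k p_bounds(2,4)[of "fst z" "snd z"] by (intro ennreal_mult) auto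
    finally show ?case by (auto simp: indicator_def)
  qed
  also have "\<dots> = ennreal (\<Lambda> * sup_fun p) * energy p K \<Omega> v"
    unfolding energy_def by (intro nn_integral_cmult) measurable
  finally have 2: "gagliardo s p \<Omega> v \<le> ennreal (\<Lambda> * sup_fun p) * energy p K \<Omega> v" .
  show ?thesis using 1 2 by (auto simp: ennreal_mult_less_top le_less_trans)
qed

text \<open>Since \<Omega> is bounded, the singular weight is bounded below on \<Omega> \<times>
  \<Omega>, and lowering the exponent from p to its infimum q there costs at most the finite measure
  of \<Omega> \<times> \<Omega>. Thus |v x - v y|^q is integrable on \<Omega> \<times> \<Omega>.
  Fubini provides one base point x with an integrable section, and v is compared with the constant v
  x.\<close>

lemma Lq_of_gagliardo_finite:
  assumes v: "v \<in> borel_measurable lebesgue" and fin: "gagliardo s p \<Omega> v < \<infinity>"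
  shows "(\<integral>\<^sup>+ x. indicator \<Omega> x * ennreal (\<bar>v x\<bar> powr inf_on p \<Omega>) \<partial>lebesgue) < \<infinity>"
proof (cases "\<Omega> = {}")
  case False
  define q where "q = inf_on p \<Omega>"
  have q: "q \<le> p x y" if "x \<in> \<Omega>" "y \<in> \<Omega>" for x y
  proof -
    have "bdd_below ((\<lambda>(x, y). p x y) ` (\<Omega> \<times> \<Omega>))"
      using p_bounds(1) by (intro bdd_belowI[of _ "inf_fun p"]) auto
    moreover have "p x y \<in> (\<lambda>(x, y). p x y) ` (\<Omega> \<times> \<Omega>)" using that by (auto intro: image_eqI[of _ _ "(x, y)"])
    ultimately show ?thesis unfolding q_def inf_on_def by (rule cInf_lower[rotated])
  qed
  have q0: "0 \<le> q"
  proof -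
    have "1 \<le> q" unfolding q_def inf_on_def
      using False p_bounds(4) by (intro cInf_greatest) (auto simp: less_imp_le)
    then show ?thesis by simp
  qed
  obtain v' where v'[measurable]: "v' \<in> borel_measurable borel" and vv': "AE x in lebesgue. v x = v' x"
    using lebesgue_borel_representative[OF v] .
  obtain D where D: "1 \<le> D" "\<And>x y. x \<in> \<Omega> \<Longrightarrow> y \<in> \<Omega> \<Longrightarrow> norm (x - y) \<le> D"
  proof -
    obtain R where R: "\<And>x. x \<in> \<Omega> \<Longrightarrow> norm x \<le> R" using bounded by (auto simp: bounded_iff)
    have "norm (x - y) \<le> max 1 (2 * R)" if "x \<in> \<Omega>" "y \<in> \<Omega>" for x y
      using norm_triangle_ineq4[of x y] R[OF that(1)] R[OF that(2)] by simp
    then show thesis using that[of "max 1 (2 * R)"] by auto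
  qed
  \<comment> \<open>An upper bound for |x - y|^(n + s p) on \<Omega> \<times> \<Omega>: since D
    \<ge> 1 and s < 1, the exponent may be raised to n + \<open>sup_fun p\<close>.\<close>
  define c where "c = D powr (real CARD('n) + sup_fun p)"
  note [measurable] = gagliardo_integrand_measurable[OF v] borel_fst_snd
  have mOO[measurable]: "\<Omega> \<times> \<Omega> \<in> sets borel" "\<Omega> \<times> \<Omega> \<in> sets lebesgue"
    using borel_open[OF open_Times[OF "open" "open"]] by auto
  have finO: "emeasure lebesgue (\<Omega> \<times> \<Omega>) < \<infinity>"
    using emeasure_bounded_finite[OF bounded_Times[OF bounded bounded]] mOO by simp
  have "(\<integral>\<^sup>+ z. indicator (\<Omega> \<times> \<Omega>) z * ennreal (\<bar>v' (fst z) - v' (snd z)\<bar> powr q) \<partial>lebesgue)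
    \<le> (\<integral>\<^sup>+ z. indicator (\<Omega> \<times> \<Omega>) z + ennreal c * (indicator (C_set \<Omega>) z *
          ennreal (\<bar>v (fst z) - v (snd z)\<bar> powr p (fst z) (snd z) /
             norm (fst z - snd z) powr (real CARD('n) + s (fst z) (snd z) * p (fst z) (snd z)))) \<partial>lebesgue)"
  proof (intro nn_integral_mono_AE, use AE_lebesgue_fst[OF vv', where ?'b = "real^'n"]
        AE_lebesgue_snd[OF vv', where ?'a = "real^'n"] in eventually_elim)
    case (elim z)
    let ?x = "fst z" and ?y = "snd z"
    let ?p = "p ?x ?y" and ?e = "real CARD('n) + s ?x ?y * p ?x ?y"
    let ?A = "\<bar>v ?x - v ?y\<bar> powr ?p"
    show ?case
    proof (cases "z \<in> \<Omega> \<times> \<Omega>")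
      case True
      then have xy: "?x \<in> \<Omega>" "?y \<in> \<Omega>" by auto
      have "?A \<le> c * (?A / norm (?x - ?y) powr ?e)"
      proof (cases "?x = ?y")
        case False
        have "s ?x ?y * ?p \<le> 1 * sup_fun p"
          using s_bounds(1,2,4)[of ?x ?y] p_bounds(1,2,4)[of ?x ?y] by (intro mult_mono) auto
        then have "norm (?x - ?y) powr ?e \<le> c"
          unfolding c_def using D xy s_bounds(1,2,4)[of ?x ?y] p_bounds(1,2,4)[of ?x ?y]
          by (intro order_trans[OF powr_mono2[of ?e "norm (?x - ?y)" D] powr_mono]) auto
        then have "?A * norm (?x - ?y) powr ?e \<le> ?A * c" by (intro mult_left_mono) auto
        then show ?thesis using False by (simp add: field_simps)
      qed simp
      moreover have "\<bar>v ?x - v ?y\<bar> powr q \<le> 1 + ?A"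
        using q[OF xy] q0 by (intro powr_le_one_plus_powr) auto
      ultimately have "ennreal (\<bar>v ?x - v ?y\<bar> powr q) \<le> ennreal (1 + c * (?A / norm (?x - ?y) powr ?e))"
        by (intro ennreal_leI) linarith
      also have "\<dots> = 1 + ennreal c * ennreal (?A / norm (?x - ?y) powr ?e)"
        by (simp only: c_def ennreal_plus ennreal_mult ennreal_1 powr_ge_zero divide_nonneg_nonneg
            mult_nonneg_nonneg zero_le_one)
      finally show ?thesis using True elim by (auto simp: C_set_def)
    qed simp
  qed
  also have "\<dots> = emeasure lebesgue (\<Omega> \<times> \<Omega>) + ennreal c * gagliardo s p \<Omega> v"
    unfolding gagliardo_def by (subst nn_integral_add) (auto simp: nn_integral_cmult)
  also have "\<dots> < \<infinity>" using finO fin by (simp add: ennreal_mult_less_top)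
  finally have "(\<integral>\<^sup>+ z. indicator (\<Omega> \<times> \<Omega>) z * ennreal (\<bar>v' (fst z) - v' (snd z)\<bar> powr q) \<partial>lebesgue) < \<infinity>" .
  then have fin2: "(\<integral>\<^sup>+x. \<integral>\<^sup>+y. indicator (\<Omega> \<times> \<Omega>) (x, y) * ennreal (\<bar>v' x - v' y\<bar> powr q) \<partial>lborel \<partial>lborel) < \<infinity>"
    by (subst (asm) nn_integral_lebesgue_pair) (auto simp: nn_integral_completion)
  have ae: "AE x in lborel. (\<integral>\<^sup>+y. indicator (\<Omega> \<times> \<Omega>) (x, y) * ennreal (\<bar>v' x - v' y\<bar> powr q) \<partial>lborel) \<noteq> \<infinity>"
    using fin2 by (intro nn_integral_PInf_AE) (auto simp: indicator_times)
  \<comment> \<open>A nonempty open set is not null, so the almost everywhere finite sections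
    include one based at a point of \<Omega>.\<close>
  have nae: "\<not> (AE x in lborel. x \<notin> \<Omega>)"
  proof
    assume "AE x in lborel. x \<notin> \<Omega>"
    then have "negligible \<Omega>"
      using AE_iff_null_sets[of \<Omega> lborel]
      by (auto simp: negligible_iff_null_sets intro: null_sets_completionI)
    then show False using "open" False by (simp add: open_not_negligible)
  qed
  obtain x where x: "x \<in> \<Omega>"
      "(\<integral>\<^sup>+y. indicator (\<Omega> \<times> \<Omega>) (x, y) * ennreal (\<bar>v' x - v' y\<bar> powr q) \<partial>lborel) \<noteq> \<infinity>"
  proof (rule ccontr)
    assume "\<not> thesis"
    then have "AE x in lborel. x \<notin> \<Omega>"
      using ae that by (auto elim!: eventually_mono)
    with nae show False by simp
  qed
  have "(\<integral>\<^sup>+ y. indicator \<Omega> y * ennreal (\<bar>v y\<bar> powr q) \<partial>lebesgue)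
      \<le> (\<integral>\<^sup>+ y. ennreal (2 powr q) * (ennreal (\<bar>v' x\<bar> powr q) * indicator \<Omega> y
          + indicator (\<Omega> \<times> \<Omega>) (x, y) * ennreal (\<bar>v' x - v' y\<bar> powr q)) \<partial>lebesgue)"
  proof (intro nn_integral_mono_AE, use vv' in eventually_elim)
    case (elim y)
    have "\<bar>v' y\<bar> powr q \<le> 2 powr q * (\<bar>v' x\<bar> powr q + \<bar>v' x - v' y\<bar> powr q)"
      using abs_add_powr_le[OF q0, of "v' x" "v' y - v' x"] by (simp add: abs_minus_commute)
    then have "ennreal (\<bar>v' y\<bar> powr q) \<le> ennreal (2 powr q) * (ennreal (\<bar>v' x\<bar> powr q) + ennreal (\<bar>v' x - v' y\<bar> powr q))"
      by (simp add: ennreal_mult[symmetric] ennreal_plus[symmetric] ennreal_leI del: ennreal_plus)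
    then show ?case using elim x by (auto simp: indicator_def)
  qed
  also have "\<dots> = (\<integral>\<^sup>+ y. ennreal (2 powr q) * (ennreal (\<bar>v' x\<bar> powr q) * indicator \<Omega> y
          + indicator (\<Omega> \<times> \<Omega>) (x, y) * ennreal (\<bar>v' x - v' y\<bar> powr q)) \<partial>lborel)"
    by (simp add: nn_integral_completion)
  also have "\<dots> = ennreal (2 powr q) * (ennreal (\<bar>v' x\<bar> powr q) * emeasure lborel \<Omega>
       + (\<integral>\<^sup>+ y. indicator (\<Omega> \<times> \<Omega>) (x, y) * ennreal (\<bar>v' x - v' y\<bar> powr q) \<partial>lborel))"
    by (simp add: nn_integral_cmult nn_integral_add indicator_times)
  also have "\<dots> < \<infinity>"
    using x(2) emeasure_bounded_finite[OF bounded] by (simp add: ennreal_mult_less_top less_top)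
  finally show ?thesis unfolding q_def .
qed simp

text \<open>In this form the limit of a minimizing sequence is placed in the space by its energy
  bound alone.\<close>

lemma W_space_iff:
  "v \<in> W_space s p \<Omega> \<longleftrightarrow> v \<in> borel_measurable lebesgue \<and> energy p K \<Omega> v < \<infinity>"
  using Lq_of_gagliardo_finite[of v] energy_finite_iff[of v]
  by (auto simp: W_space_def gagliardo_def)

section \<open>The energy as a modular, and comparison of near minimizers\<close>

text \<open>With kernel and factor 1 / p absorbed into the measure, the energy is the modular of the
  increment function z \<mapsto> v (fst z) - v (snd z), and the abstract L1 estimate for near
  minimizers applies to it. Negative values of K, possible on a null set only, are cut to 0 by
  \<open>ennreal\<close>.\<close>

definition energy_measure :: "((real^'n) \<times> (real^'n)) measure" where
  "energy_measure = density lebesgue (\<lambda>z. indicator (C_set \<Omega>) z * ennreal (K (fst z) (snd z) / p (fst z) (snd z)))"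

lemma sets_energy_measure [simp, measurable_cong]: "sets energy_measure = sets lebesgue"
  by (simp add: energy_measure_def)

lemma nn_integral_energy_measure:
  assumes [measurable]: "f \<in> borel_measurable lebesgue"
  shows "(\<integral>\<^sup>+z. f z \<partial>energy_measure) = (\<integral>\<^sup>+z. indicator (C_set \<Omega>) z * ennreal (K (fst z) (snd z) / p (fst z) (snd z)) * f z \<partial>lebesgue)"
  unfolding energy_measure_def by (intro nn_integral_density) measurable

lemma energy_eq_nn_integral:
  assumes v: "v \<in> borel_measurable lebesgue"
  shows "energy p K \<Omega> v = (\<integral>\<^sup>+z. ennreal (\<bar>v (fst z) - v (snd z)\<bar> powr p (fst z) (snd z)) \<partial>energy_measure)"
proof -
  note [measurable] = lebesgue_measurable_fst[OF v] lebesgue_measurable_snd[OF v]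
  have "ennreal (1 / a * b * k) = ennreal (k / a) * ennreal b" if "0 \<le> b" for a b k :: real
    using ennreal_mult''[OF that, of "k / a"] by (simp add: mult.commute)
  then show ?thesis
    unfolding energy_def by (subst nn_integral_energy_measure) (auto simp: mult.assoc)
qed

lemma energy_midpoint_finite:
  assumes u: "u \<in> borel_measurable lebesgue" "energy p K \<Omega> u < \<infinity>"
    and v: "v \<in> borel_measurable lebesgue" "energy p K \<Omega> v < \<infinity>"
  shows "energy p K \<Omega> (\<lambda>x. (u x + v x) / 2) < \<infinity>"
proof -
  note [measurable] = u(1) v(1) lebesgue_measurable_fst[OF u(1)] lebesgue_measurable_snd[OF u(1)]
    lebesgue_measurable_fst[OF v(1)] lebesgue_measurable_snd[OF v(1)]
  have "energy p K \<Omega> (\<lambda>x. (u x + v x) / 2) \<le>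
    (\<integral>\<^sup>+z. ennreal (\<bar>u (fst z) - u (snd z)\<bar> powr p (fst z) (snd z))
        + ennreal (\<bar>v (fst z) - v (snd z)\<bar> powr p (fst z) (snd z)) \<partial>energy_measure)"
  proof (subst energy_eq_nn_integral, measurable, intro nn_integral_mono)
    fix z :: "(real^'n) \<times> (real^'n)"
    let ?a = "u (fst z) - u (snd z)" and ?b = "v (fst z) - v (snd z)" and ?p = "p (fst z) (snd z)"
    have "\<bar>(?a + ?b) / 2\<bar> powr ?p \<le> (\<bar>?a\<bar> powr ?p + \<bar>?b\<bar> powr ?p) / 2"
      using p_bounds(4) by (rule abs_powr_midpoint_le)
    also have "\<dots> \<le> \<bar>?a\<bar> powr ?p + \<bar>?b\<bar> powr ?p" by simp
    also have "(?a + ?b) / 2 = (u (fst z) + v (fst z)) / 2 - (u (snd z) + v (snd z)) / 2"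
      by (simp add: field_simps)
    finally show "ennreal (\<bar>(u (fst z) + v (fst z)) / 2 - (u (snd z) + v (snd z)) / 2\<bar> powr ?p)
        \<le> ennreal (\<bar>?a\<bar> powr ?p) + ennreal (\<bar>?b\<bar> powr ?p)"
      by (simp add: ennreal_leI flip: ennreal_plus)
  qed
  also have "\<dots> = energy p K \<Omega> u + energy p K \<Omega> v"
    unfolding energy_eq_nn_integral[OF u(1)] energy_eq_nn_integral[OF v(1)]
    by (intro nn_integral_add) measurable
  finally show ?thesis using u v by (simp add: le_less_trans)
qed

text \<open>Functions that agree off \<open>\<Omega>\<close> are compared through their interaction with a ball \<open>A\<close> far
  from \<open>\<Omega>\<close>: there the kernel is bounded above and below and the difference of the increments is
  the difference of the functions, so no Poincare inequality is needed.\<close>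
lemma near_minimizers_close:
  assumes "0 < \<eta>" "0 \<le> I"
  obtains \<delta> where "0 < \<delta>" and
    "\<And>u v. u \<in> borel_measurable lebesgue \<Longrightarrow> v \<in> borel_measurable lebesgue \<Longrightarrow>
       AE x in lebesgue. x \<notin> \<Omega> \<longrightarrow> u x = v x \<Longrightarrow>
       energy p K \<Omega> u \<le> ennreal (I + \<delta>) \<Longrightarrow> energy p K \<Omega> v \<le> ennreal (I + \<delta>) \<Longrightarrow>
       ennreal I \<le> energy p K \<Omega> (\<lambda>x. (u x + v x) / 2) \<Longrightarrow>
       (\<integral>\<^sup>+x. indicator \<Omega> x * ennreal \<bar>u x - v x\<bar> \<partial>lebesgue) \<le> ennreal \<eta>"
proof -
  obtain R where R: "0 < R" "\<And>x. x \<in> \<Omega> \<Longrightarrow> norm x \<le> R"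
    using bounded by (auto simp: bounded_pos)
  \<comment> \<open>A unit ball centred at norm R + 2 has norms between R + 1 and R + 3, hence
    distances to points of \<Omega> between 1 and 2 R + 3.\<close>
  obtain a :: "real^'n" where a: "norm a = R + 2"
    using vector_choose_size[of "R + 2"] R by auto
  define A where "A = ball a 1"
  define D where "D = 2 * R + 3"
  have far: "1 \<le> norm (x - y)" "norm (x - y) \<le> D" "y \<notin> \<Omega>" if "x \<in> \<Omega>" "y \<in> A" for x y
  proof -
    have y: "R + 1 \<le> norm y" "norm y \<le> R + 3"
      using that(2) a norm_triangle_ineq2[of a y] norm_triangle_ineq2[of y a]
      by (auto simp: A_def dist_norm norm_minus_commute)
    have "norm x \<le> R" using R that by auto
    then show "1 \<le> norm (x - y)" "norm (x - y) \<le> D"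
      using y norm_triangle_ineq2[of y x] norm_triangle_ineq4[of x y]
      by (auto simp: D_def norm_minus_commute)
    show "y \<notin> \<Omega>" using R(2)[of y] y by auto
  qed
  have mB[measurable]: "\<Omega> \<times> A \<in> sets borel" "\<Omega> \<times> A \<in> sets lebesgue" "A \<in> sets borel"
    using borel_open[OF open_Times[OF "open", of A]] by (auto simp: A_def)
  have boundA: "bounded A" by (simp add: A_def)
  define \<alpha> where "\<alpha> = measure lborel A"
  have \<alpha>: "emeasure lborel A = ennreal \<alpha>" "0 < \<alpha>"
    using emeasure_bounded_finite[OF boundA] content_ball_pos[of 1 a]
    by (auto simp: \<alpha>_def A_def emeasure_eq_ennreal_measure)
  obtain \<Lambda> where \<Lambda>: "1 < \<Lambda>"
    "AE z in (lebesgue :: ((real^'n) \<times> (real^'n)) measure).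
       1 / \<Lambda> / norm (fst z - snd z) powr (real CARD('n) + s (fst z) (snd z) * p (fst z) (snd z))
          \<le> K (fst z) (snd z)"
    "AE z in (lebesgue :: ((real^'n) \<times> (real^'n)) measure). K (fst z) (snd z) \<le>
          \<Lambda> / norm (fst z - snd z) powr (real CARD('n) + s (fst z) (snd z) * p (fst z) (snd z))"
    by (rule kernel_bounds)
  \<comment> \<open>The lower bound for the density K / p on \<Omega> \<times> A: the kernel at the
    largest distance D with the largest exponent, divided by the largest p.\<close>
  define c where "c = 1 / \<Lambda> / D powr (real CARD('n) + sup_fun p) / sup_fun p"
  have p1: "1 < sup_fun p" using p_bounds(2,4) by (meson less_le_trans)
  have D: "1 \<le> D" using R by (auto simp: D_def)
  have c: "0 < c" using \<Lambda>(1) p1 D by (auto simp: c_def)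
  have N: "1 \<le> norm (x - y) powr (real CARD('n) + s x y * p x y)"
    "norm (x - y) powr (real CARD('n) + s x y * p x y) \<le> D powr (real CARD('n) + sup_fun p)"
    if "x \<in> \<Omega>" "y \<in> A" for x y
  proof -
    have "0 \<le> s x y * p x y" using s_bounds(4)[of x y] p_bounds(4)[of x y] by simp
    moreover have "s x y * p x y \<le> 1 * sup_fun p"
      using s_bounds(1,2,4)[of x y] p_bounds(1,2,4)[of x y] by (intro mult_mono) auto
    ultimately show "1 \<le> norm (x - y) powr (real CARD('n) + s x y * p x y)"
      "norm (x - y) powr (real CARD('n) + s x y * p x y) \<le> D powr (real CARD('n) + sup_fun p)"
      using far[OF that] D
      by (auto intro!: ge_one_powr_ge_zero order_trans[OF powr_mono2[of _ "norm (x - y)" D] powr_mono])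
  qed
  have upper: "AE z in lebesgue. z \<in> \<Omega> \<times> A \<longrightarrow> K (fst z) (snd z) / p (fst z) (snd z) \<le> \<Lambda>"
    using \<Lambda>(3)
  proof eventually_elim
    case (elim z)
    show ?case
    proof
      assume "z \<in> \<Omega> \<times> A"
      then have "1 \<le> norm (fst z - snd z) powr (real CARD('n) + s (fst z) (snd z) * p (fst z) (snd z))"
        by (intro N) auto
      then have "K (fst z) (snd z) \<le> \<Lambda>"
        using \<Lambda>(1) by (intro order_trans[OF elim]) (simp add: divide_le_eq)
      also have "\<dots> \<le> \<Lambda> * p (fst z) (snd z)" using \<Lambda>(1) p_bounds(4)[of "fst z" "snd z"] by simp
      finally show "K (fst z) (snd z) / p (fst z) (snd z) \<le> \<Lambda>"
        using p_bounds(4)[of "fst z" "snd z"] by (simp add: divide_le_eq)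
    qed
  qed
  have lower: "AE z in lebesgue. z \<in> \<Omega> \<times> A \<longrightarrow> c \<le> K (fst z) (snd z) / p (fst z) (snd z)"
    using \<Lambda>(2)
  proof eventually_elim
    case (elim z)
    show ?case
    proof
      assume z: "z \<in> \<Omega> \<times> A"
      let ?N = "norm (fst z - snd z) powr (real CARD('n) + s (fst z) (snd z) * p (fst z) (snd z))"
      have N': "1 \<le> ?N" "?N \<le> D powr (real CARD('n) + sup_fun p)" using z by (auto intro!: N)
      have "1 / \<Lambda> / D powr (real CARD('n) + sup_fun p) \<le> 1 / \<Lambda> / ?N"
      proof (rule frac_le)
        show "0 < ?N" using N'(1) by linarith
      qed (use N' \<Lambda>(1) in auto)
      also note elim
      finally have k: "1 / \<Lambda> / D powr (real CARD('n) + sup_fun p) \<le> K (fst z) (snd z)" .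
      have "0 \<le> 1 / \<Lambda> / D powr (real CARD('n) + sup_fun p)" using \<Lambda>(1) by simp
      from order_trans[OF this k] k have "1 / \<Lambda> / D powr (real CARD('n) + sup_fun p) / sup_fun p \<le> K (fst z) (snd z) / p (fst z) (snd z)"
        using p_bounds(2,4)[of "fst z" "snd z"] by (intro frac_le) auto
      then show "c \<le> K (fst z) (snd z) / p (fst z) (snd z)" by (simp add: c_def)
    qed
  qed
  have "emeasure energy_measure (\<Omega> \<times> A)
      = (\<integral>\<^sup>+z. indicator (C_set \<Omega>) z * ennreal (K (fst z) (snd z) / p (fst z) (snd z)) * indicator (\<Omega> \<times> A) z \<partial>lebesgue)"
    using nn_integral_energy_measure[of "indicator (\<Omega> \<times> A)"] by simp
  also have "\<dots> \<le> (\<integral>\<^sup>+z. ennreal \<Lambda> * indicator (\<Omega> \<times> A) z \<partial>lebesgue)"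
    by (intro nn_integral_mono_AE, use upper in eventually_elim) (auto simp: indicator_def intro: ennreal_leI)
  also have "\<dots> = ennreal \<Lambda> * emeasure lebesgue (\<Omega> \<times> A)" by (simp add: nn_integral_cmult)
  also have "\<dots> < \<infinity>"
    using emeasure_bounded_finite[OF bounded_Times[OF bounded boundA]] mB by (simp add: ennreal_mult_less_top)
  finally have finB: "emeasure energy_measure (\<Omega> \<times> A) < \<infinity>" .
  have mp: "(\<lambda>z. p (fst z) (snd z)) \<in> borel_measurable energy_measure"
    using measurable_data by (simp cong: measurable_cong_sets)
  \<comment> \<open>The target is c \<alpha> \<eta> because the density contributes at least c and
    the integration over the second variable contributes the volume \<alpha> of A; both are divided
    out at the end.\<close>
  obtain \<delta> where \<delta>: "0 < \<delta>" and close: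
    "\<And>f h. f \<in> borel_measurable energy_measure \<Longrightarrow> h \<in> borel_measurable energy_measure \<Longrightarrow>
       (\<integral>\<^sup>+z. ennreal (\<bar>f z\<bar> powr p (fst z) (snd z)) \<partial>energy_measure) \<le> ennreal (I + \<delta>) \<Longrightarrow>
       (\<integral>\<^sup>+z. ennreal (\<bar>h z\<bar> powr p (fst z) (snd z)) \<partial>energy_measure) \<le> ennreal (I + \<delta>) \<Longrightarrow>
       ennreal I \<le> (\<integral>\<^sup>+z. ennreal (\<bar>(f z + h z) / 2\<bar> powr p (fst z) (snd z)) \<partial>energy_measure) \<Longrightarrow>
       (\<integral>\<^sup>+z. indicator (\<Omega> \<times> A) z * ennreal \<bar>f z - h z\<bar> \<partial>energy_measure) \<le> ennreal (c * \<alpha> * \<eta>)"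
  proof (rule near_minimizers_L1_close[OF mp])
    show "inf_fun p \<le> p (fst z) (snd z)" "p (fst z) (snd z) \<le> sup_fun p" "1 < inf_fun p" for z :: "(real^'n) \<times> (real^'n)"
      by (rule p_bounds)+
    show "\<Omega> \<times> A \<in> sets energy_measure" using mB by simp
    show "emeasure energy_measure (\<Omega> \<times> A) < \<infinity>" by (rule finB)
    show "0 < c * \<alpha> * \<eta>" using c \<alpha> assms by simp
    show "0 \<le> I" by (rule assms)
  qed blast
  show thesis
  proof (rule that[OF \<delta>])
    fix u v assume u: "u \<in> borel_measurable lebesgue" and v: "v \<in> borel_measurable lebesgue"
      and eq: "AE x in lebesgue. x \<notin> \<Omega> \<longrightarrow> u x = v x"
      and eu: "energy p K \<Omega> u \<le> ennreal (I + \<delta>)" and ev: "energy p K \<Omega> v \<le> ennreal (I + \<delta>)"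
      and em: "ennreal I \<le> energy p K \<Omega> (\<lambda>x. (u x + v x) / 2)"
    note [measurable] = u v lebesgue_measurable_fst[OF u] lebesgue_measurable_snd[OF u]
      lebesgue_measurable_fst[OF v] lebesgue_measurable_snd[OF v]
    let ?f = "\<lambda>z. u (fst z) - u (snd z)" and ?h = "\<lambda>z. v (fst z) - v (snd z)"
    have "ennreal I \<le> (\<integral>\<^sup>+z. ennreal (\<bar>(?f z + ?h z) / 2\<bar> powr p (fst z) (snd z)) \<partial>energy_measure)"
    proof -
      have "(?f z + ?h z) / 2 = (u (fst z) + v (fst z)) / 2 - (u (snd z) + v (snd z)) / 2" for z
        by (simp add: field_simps)
      moreover have "(\<lambda>x. (u x + v x) / 2) \<in> borel_measurable lebesgue" by measurable
      ultimately show ?thesis using em by (simp only: energy_eq_nn_integral)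
    qed
    then have le: "(\<integral>\<^sup>+z. indicator (\<Omega> \<times> A) z * ennreal \<bar>?f z - ?h z\<bar> \<partial>energy_measure) \<le> ennreal (c * \<alpha> * \<eta>)"
      using eu ev by (intro close) (simp_all add: energy_eq_nn_integral[OF u] energy_eq_nn_integral[OF v])
    \<comment> \<open>Fubini is available for Borel integrands, so u - v is replaced by a Borel
      representative before the integral over \<Omega> \<times> A is split.\<close>
    obtain w where w[measurable]: "w \<in> borel_measurable borel" and wuv: "AE x in lebesgue. u x - v x = w x"
      using lebesgue_borel_representative[of "\<lambda>x. u x - v x"] u v by auto
    note [measurable] = borel_fst_snd
    let ?J = "\<integral>\<^sup>+x. indicator \<Omega> x * ennreal \<bar>w x\<bar> \<partial>lborel"
    have "ennreal c * (?J * ennreal \<alpha>) = ennreal c * (\<integral>\<^sup>+z. indicator (\<Omega> \<times> A) z * ennreal \<bar>w (fst z)\<bar> \<partial>lebesgue)"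
    proof -
      have "(\<integral>\<^sup>+z. indicator (\<Omega> \<times> A) z * ennreal \<bar>w (fst z)\<bar> \<partial>lebesgue)
         = (\<integral>\<^sup>+x. \<integral>\<^sup>+y. indicator \<Omega> x * ennreal \<bar>w x\<bar> * indicator A y \<partial>lborel \<partial>lborel)"
        by (subst nn_integral_lebesgue_pair) (auto simp: nn_integral_completion indicator_times mult_ac)
      also have "\<dots> = ?J * ennreal \<alpha>"
        by (simp add: nn_integral_cmult nn_integral_multc \<alpha>)
      finally show ?thesis by simp
    qed
    also have "\<dots> = (\<integral>\<^sup>+z. ennreal c * (indicator (\<Omega> \<times> A) z * ennreal \<bar>w (fst z)\<bar>) \<partial>lebesgue)"
      by (intro nn_integral_cmult[symmetric] lebesgue_measurable_borel) measurable
    also have "\<dots> \<le> (\<integral>\<^sup>+z. indicator (C_set \<Omega>) z * ennreal (K (fst z) (snd z) / p (fst z) (snd z))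
          * (indicator (\<Omega> \<times> A) z * ennreal \<bar>?f z - ?h z\<bar>) \<partial>lebesgue)"
    proof (intro nn_integral_mono_AE, use lower AE_lebesgue_fst[OF wuv, where ?'b = "real^'n"]
        AE_lebesgue_snd[OF eq, where ?'a = "real^'n"] in eventually_elim)
      case (elim z)
      show ?case
      proof (cases "z \<in> \<Omega> \<times> A")
        case True
        then have "snd z \<notin> \<Omega>" "z \<in> C_set \<Omega>" using far(3)[of "fst z" "snd z"] by (auto simp: C_set_def)
        moreover from this have "?f z - ?h z = w (fst z)" using elim by simp
        moreover have "ennreal c * ennreal \<bar>w (fst z)\<bar> \<le> ennreal (K (fst z) (snd z) / p (fst z) (snd z)) * ennreal \<bar>w (fst z)\<bar>"
          using elim True by (intro mult_right_mono ennreal_leI) auto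
        ultimately show ?thesis using True by simp
      qed simp
    qed
    also have "\<dots> = (\<integral>\<^sup>+z. indicator (\<Omega> \<times> A) z * ennreal \<bar>?f z - ?h z\<bar> \<partial>energy_measure)"
      by (intro nn_integral_energy_measure[symmetric]) measurable
    also note le
    finally have "ennreal (c * \<alpha>) * ?J \<le> ennreal (c * \<alpha>) * ennreal \<eta>"
      using c \<alpha> assms by (simp add: ennreal_mult mult_ac)
    then have "?J \<le> ennreal \<eta>"
      using c \<alpha> by (subst (asm) ennreal_mult_le_mult_iff) auto
    moreover have "(\<integral>\<^sup>+x. indicator \<Omega> x * ennreal \<bar>u x - v x\<bar> \<partial>lebesgue) = (\<integral>\<^sup>+x. indicator \<Omega> x * ennreal \<bar>w x\<bar> \<partial>lebesgue)"
      by (intro nn_integral_cong_AE, use wuv in eventually_elim) simp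
    ultimately show "(\<integral>\<^sup>+x. indicator \<Omega> x * ennreal \<bar>u x - v x\<bar> \<partial>lebesgue) \<le> ennreal \<eta>"
      by (simp add: nn_integral_completion)
  qed
qed

end

section \<open>Existence and uniqueness\<close>

lemma AE_convergent_of_nn_integral_diff_le:
  fixes f :: "nat \<Rightarrow> 'a \<Rightarrow> real"
  assumes [measurable]: "\<And>k. f k \<in> borel_measurable M" "B \<in> sets M"
    and le: "\<And>k. (\<integral>\<^sup>+x. indicator B x * ennreal \<bar>f k x - f (Suc k) x\<bar> \<partial>M) \<le> ennreal ((1 / 2) ^ k)"
  shows "AE x in M. x \<in> B \<longrightarrow> convergent (\<lambda>k. f k x)"
proof -
  have "(\<integral>\<^sup>+x. (\<Sum>k. indicator B x * ennreal \<bar>f k x - f (Suc k) x\<bar>) \<partial>M)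
      = (\<Sum>k. \<integral>\<^sup>+x. indicator B x * ennreal \<bar>f k x - f (Suc k) x\<bar> \<partial>M)"
    by (intro nn_integral_suminf) measurable
  also have "\<dots> \<le> (\<Sum>k. ennreal ((1 / 2) ^ k))"
    by (intro suminf_le le) auto
  also have "\<dots> = ennreal (\<Sum>k. (1 / 2) ^ k)"
    by (intro suminf_ennreal2 summable_geometric) auto
  also have "\<dots> < \<infinity>" by simp
  finally have "AE x in M. (\<Sum>k. indicator B x * ennreal \<bar>f k x - f (Suc k) x\<bar>) \<noteq> \<infinity>"
    by (intro nn_integral_PInf_AE) (auto simp: less_top[symmetric])
  then show ?thesis
  proof eventually_elim
    case (elim x)
    show ?case
    proof
      assume "x \<in> B"
      with elim have "summable (\<lambda>k. \<bar>f k x - f (Suc k) x\<bar>)"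
        by (intro summable_suminf_not_top) auto
      then have "summable (\<lambda>k. \<bar>f (Suc k) x - f k x\<bar>)" by (simp add: abs_minus_commute)
      then have "summable (\<lambda>k. f (Suc k) x - f k x)" by (rule summable_rabs_cancel)
      then have "(\<lambda>n. \<Sum>k<n. f (Suc k) x - f k x) \<longlonglongrightarrow> (\<Sum>k. f (Suc k) x - f k x)"
        by (rule summable_LIMSEQ)
      then have "(\<lambda>n. f n x - f 0 x) \<longlonglongrightarrow> (\<Sum>k. f (Suc k) x - f k x)"
        unfolding sum_lessThan_telescope[of "\<lambda>n. f n x"] .
      then have "(\<lambda>n. (f n x - f 0 x) + f 0 x) \<longlonglongrightarrow> (\<Sum>k. f (Suc k) x - f k x) + f 0 x"
        by (intro tendsto_intros)
      then show "convergent (\<lambda>k. f k x)" by (auto simp: convergent_def)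
    qed
  qed
qed

context variable_order_energy
begin

definition admissible :: "(real^'n \<Rightarrow> real) \<Rightarrow> (real^'n \<Rightarrow> real) set" where
  "admissible g = {v \<in> W_space s p \<Omega>. AE x in lebesgue. x \<notin> \<Omega> \<longrightarrow> v x = g x}"

lemma admissible_measurable: "v \<in> admissible g \<Longrightarrow> v \<in> borel_measurable lebesgue"
  by (simp add: admissible_def W_space_iff)

lemma admissible_eq: "u \<in> admissible g \<Longrightarrow> v \<in> admissible g \<Longrightarrow> AE x in lebesgue. x \<notin> \<Omega> \<longrightarrow> u x = v x"
  unfolding admissible_def by (auto elim: eventually_elim2)

lemma admissible_midpoint:
  assumes "u \<in> admissible g" "v \<in> admissible g"
  shows "(\<lambda>x. (u x + v x) / 2) \<in> admissible g"
proof -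
  have m: "u \<in> borel_measurable lebesgue" "v \<in> borel_measurable lebesgue"
    using assms by (auto intro: admissible_measurable)
  have "(\<lambda>x. (u x + v x) / 2) \<in> W_space s p \<Omega>"
    using assms m energy_midpoint_finite[OF m(1) _ m(2)] by (simp add: admissible_def W_space_iff)
  moreover have "AE x in lebesgue. x \<notin> \<Omega> \<longrightarrow> (u x + v x) / 2 = g x"
    using assms unfolding admissible_def by (auto elim: eventually_elim2)
  ultimately show ?thesis by (simp add: admissible_def)
qed

text \<open>Null sets of the line factor pull back under both projections, so the increments
  converge at almost every pair; Fatou does the rest. Positivity of p is what makes the powers
  converge where the limit increment is 0.\<close>

lemma energy_lower_semicontinuous:
  assumes v: "\<And>k. v k \<in> borel_measurable lebesgue" and u: "u \<in> borel_measurable lebesgue"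
    and lim: "AE x in lebesgue. (\<lambda>k. v k x) \<longlonglongrightarrow> u x"
  shows "energy p K \<Omega> u \<le> liminf (\<lambda>k. energy p K \<Omega> (v k))"
proof -
  let ?F = "\<lambda>v z. indicator (C_set \<Omega>) z * ennreal (1 / p (fst z) (snd z) *
      \<bar>v (fst z) - v (snd z)\<bar> powr p (fst z) (snd z) * K (fst z) (snd z)) :: ennreal"
  have meas: "?F (v k) \<in> borel_measurable lebesgue" for k
    using energy_integrand_measurable[OF v[of k]] by measurable
  have "energy p K \<Omega> u \<le> (\<integral>\<^sup>+z. liminf (\<lambda>k. ?F (v k) z) \<partial>lebesgue)"
    unfolding energy_def
  proof (intro nn_integral_mono_AE, use AE_lebesgue_fst[OF lim, where ?'b = "real^'n"]
      AE_lebesgue_snd[OF lim, where ?'a = "real^'n"] in eventually_elim)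
    case (elim z)
    have "(\<lambda>k. \<bar>v k (fst z) - v k (snd z)\<bar> powr p (fst z) (snd z))
        \<longlonglongrightarrow> \<bar>u (fst z) - u (snd z)\<bar> powr p (fst z) (snd z)"
      using p_bounds(4)[of "fst z" "snd z"] by (intro tendsto_powr' tendsto_intros elim) auto
    then have "(\<lambda>k. ennreal (1 / p (fst z) (snd z) *
      \<bar>v k (fst z) - v k (snd z)\<bar> powr p (fst z) (snd z) * K (fst z) (snd z)))
      \<longlonglongrightarrow> ennreal (1 / p (fst z) (snd z) *
      \<bar>u (fst z) - u (snd z)\<bar> powr p (fst z) (snd z) * K (fst z) (snd z))"
      by (intro tendsto_ennrealI tendsto_mult tendsto_const)
    then have "(\<lambda>k. ?F (v k) z) \<longlonglongrightarrow> ?F u z"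
      by (cases "z \<in> C_set \<Omega>") auto
    then have "liminf (\<lambda>k. ?F (v k) z) = ?F u z"
      by (intro lim_imp_Liminf) auto
    then show ?case by simp
  qed
  also have "\<dots> \<le> liminf (\<lambda>k. \<integral>\<^sup>+z. ?F (v k) z \<partial>lebesgue)"
    by (intro nn_integral_liminf meas)
  finally show ?thesis unfolding energy_def .
qed

lemma minimizer_exists:
  assumes g: "g \<in> W_space s p \<Omega>"
  shows "\<exists>u\<in>admissible g. \<forall>v\<in>admissible g. energy p K \<Omega> u \<le> energy p K \<Omega> v"
proof -
  have gA: "g \<in> admissible g" using g by (simp add: admissible_def)
  define I where "I = (INF v\<in>admissible g. energy p K \<Omega> v)"
  have I_le: "I \<le> energy p K \<Omega> v" if "v \<in> admissible g" for v
    unfolding I_def using that by (rule INF_lower)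
  have "I < \<infinity>" using I_le[OF gA] g by (simp add: W_space_iff le_less_trans)
  then obtain r where r: "I = ennreal r" "0 \<le> r" by (cases I) auto
  \<comment> \<open>\<open>P k \<delta>\<close> bundles the closeness statement at scale 2^-k, so
    that a tolerance for every k can be picked by choice.\<close>
  define P where "P k \<delta> \<longleftrightarrow> 0 < \<delta> \<and> (\<forall>u\<in>admissible g. \<forall>v\<in>admissible g.
       energy p K \<Omega> u \<le> ennreal (r + \<delta>) \<longrightarrow> energy p K \<Omega> v \<le> ennreal (r + \<delta>) \<longrightarrow>
       (\<integral>\<^sup>+x. indicator \<Omega> x * ennreal \<bar>u x - v x\<bar> \<partial>lebesgue) \<le> ennreal ((1 / 2) ^ k))" for k \<delta>
  have "\<exists>\<delta>. P k \<delta>" for k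
  proof -
    obtain \<delta> where \<delta>: "0 < \<delta>" and *:
     "\<And>u v. u \<in> borel_measurable lebesgue \<Longrightarrow> v \<in> borel_measurable lebesgue \<Longrightarrow>
       AE x in lebesgue. x \<notin> \<Omega> \<longrightarrow> u x = v x \<Longrightarrow>
       energy p K \<Omega> u \<le> ennreal (r + \<delta>) \<Longrightarrow> energy p K \<Omega> v \<le> ennreal (r + \<delta>) \<Longrightarrow>
       ennreal r \<le> energy p K \<Omega> (\<lambda>x. (u x + v x) / 2) \<Longrightarrow>
       (\<integral>\<^sup>+x. indicator \<Omega> x * ennreal \<bar>u x - v x\<bar> \<partial>lebesgue) \<le> ennreal ((1 / 2) ^ k)"
      using near_minimizers_close[of "(1 / 2) ^ k" r] r(2) by auto
    show ?thesis unfolding P_def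
    proof (intro exI conjI ballI impI)
      fix u v assume uv: "u \<in> admissible g" "v \<in> admissible g"
        and e: "energy p K \<Omega> u \<le> ennreal (r + \<delta>)" "energy p K \<Omega> v \<le> ennreal (r + \<delta>)"
      show "(\<integral>\<^sup>+x. indicator \<Omega> x * ennreal \<bar>u x - v x\<bar> \<partial>lebesgue) \<le> ennreal ((1 / 2) ^ k)"
        using I_le[OF admissible_midpoint[OF uv]] r(1)
        by (intro * admissible_measurable[OF uv(1)] admissible_measurable[OF uv(2)] admissible_eq[OF uv] e) simp
    qed (rule \<delta>)
  qed
  then have "\<forall>k. \<exists>\<delta>. P k \<delta>" ..
  from choice[OF this] obtain \<delta> where P: "\<And>k. P k (\<delta> k)" by blast
  have \<delta>: "0 < \<delta> k" for k using P[of k] by (simp add: P_def)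
  have close: "(\<integral>\<^sup>+x. indicator \<Omega> x * ennreal \<bar>u x - v x\<bar> \<partial>lebesgue) \<le> ennreal ((1 / 2) ^ k)"
    if "u \<in> admissible g" "v \<in> admissible g"
      "energy p K \<Omega> u \<le> ennreal (r + \<delta> k)" "energy p K \<Omega> v \<le> ennreal (r + \<delta> k)" for k u v
    using P[of k] that by (simp add: P_def)
  \<comment> \<open>A running minimum is decreasing, so \<open>v k\<close> and
    \<open>v (Suc k)\<close> both lie below r + \<delta> k. The entries 2^-i also force the energies
    down to r.\<close>
  define d where "d k = Min ((\<lambda>i. min (\<delta> i) ((1 / 2) ^ i)) ` {..k})" for k
  have d: "0 < d k" "d k \<le> \<delta> k" "d k \<le> (1 / 2) ^ k" "d (Suc k) \<le> d k" for k
  proof -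
    show "0 < d k" using \<delta> by (auto simp: d_def)
    have "d k \<le> min (\<delta> k) ((1 / 2) ^ k)" unfolding d_def by (intro Min_le) auto
    then show "d k \<le> \<delta> k" "d k \<le> (1 / 2) ^ k" by auto
    show "d (Suc k) \<le> d k" unfolding d_def by (intro Min_antimono) auto
  qed
  have "\<exists>v\<in>admissible g. energy p K \<Omega> v < ennreal (r + d k)" for k
  proof -
    have "I < ennreal (r + d k)" using r d(1)[of k] by (simp add: ennreal_less_iff)
    then show ?thesis unfolding I_def by (simp add: INF_less_iff)
  qed
  then obtain v where vA: "\<And>k. v k \<in> admissible g" and ev: "\<And>k. energy p K \<Omega> (v k) < ennreal (r + d k)"
    by metis
  note [measurable] = admissible_measurable[OF vA] admissible_measurable[OF gA]
  have "(\<integral>\<^sup>+x. indicator \<Omega> x * ennreal \<bar>v k x - v (Suc k) x\<bar> \<partial>lebesgue) \<le> ennreal ((1 / 2) ^ k)" for k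
  proof (rule close[OF vA vA])
    show "energy p K \<Omega> (v k) \<le> ennreal (r + \<delta> k)"
      using ev[of k] d(2)[of k] by (meson add_left_mono ennreal_leI less_imp_le order_trans)
    show "energy p K \<Omega> (v (Suc k)) \<le> ennreal (r + \<delta> k)"
      using ev[of "Suc k"] d(2,4)[of k] by (meson add_left_mono ennreal_leI less_imp_le order_trans)
  qed
  then have conv: "AE x in lebesgue. x \<in> \<Omega> \<longrightarrow> convergent (\<lambda>k. v k x)"
    by (intro AE_convergent_of_nn_integral_diff_le) measurable
  \<comment> \<open>Convergence is known only in \<Omega>; off \<Omega> the limit is set to g
    itself, which every member of the sequence equals almost everywhere.\<close>
  define u where "u x = (if x \<in> \<Omega> then lim (\<lambda>k. v k x) else g x)" for x
  have um: "u \<in> borel_measurable lebesgue" unfolding u_def by measurable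
  have "AE x in lebesgue. \<forall>k. x \<notin> \<Omega> \<longrightarrow> v k x = g x"
    using vA unfolding AE_all_countable by (simp add: admissible_def)
  with conv have lim: "AE x in lebesgue. (\<lambda>k. v k x) \<longlonglongrightarrow> u x"
    by eventually_elim (auto simp: u_def convergent_LIMSEQ_iff)
  have "energy p K \<Omega> u \<le> liminf (\<lambda>k. energy p K \<Omega> (v k))"
    by (intro energy_lower_semicontinuous um lim admissible_measurable[OF vA])
  also have "\<dots> \<le> liminf (\<lambda>k. ennreal (r + (1 / 2) ^ k))"
    using ev d(3) by (intro Liminf_mono always_eventually allI)
      (meson add_left_mono ennreal_leI less_imp_le order_trans)
  also have "\<dots> = ennreal r"
  proof (intro lim_imp_Liminf tendsto_ennrealI)
    show "(\<lambda>k. r + (1 / 2) ^ k) \<longlonglongrightarrow> r"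
      using tendsto_add[OF tendsto_const LIMSEQ_power_zero[of "1 / 2 :: real"], of r] by simp
  qed simp
  finally have le: "energy p K \<Omega> u \<le> I" by (simp add: r)
  have "u \<in> admissible g"
    using um le \<open>I < \<infinity>\<close> by (auto simp: admissible_def W_space_iff u_def le_less_trans)
  then show ?thesis using le I_le order_trans by blast
qed

lemma minimizer_unique:
  assumes u: "u \<in> admissible g" "\<And>v. v \<in> admissible g \<Longrightarrow> energy p K \<Omega> u \<le> energy p K \<Omega> v"
    and w: "w \<in> admissible g" "\<And>v. v \<in> admissible g \<Longrightarrow> energy p K \<Omega> w \<le> energy p K \<Omega> v"
  shows "AE x in lebesgue. w x = u x"
proof -
  note [measurable] = admissible_measurable[OF u(1)] admissible_measurable[OF w(1)]
  have "energy p K \<Omega> u < \<infinity>" using u(1) by (simp add: admissible_def W_space_iff)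
  then obtain r where r: "energy p K \<Omega> u = ennreal r" "0 \<le> r" by (cases "energy p K \<Omega> u") auto
  have rw: "energy p K \<Omega> w = ennreal r" using u w r by (metis order_antisym)
  let ?J = "\<integral>\<^sup>+x. indicator \<Omega> x * ennreal \<bar>w x - u x\<bar> \<partial>lebesgue"
  \<comment> \<open>Both energies equal r and the midpoint has energy at least r, so the two
    minimizers are near minimizers for every tolerance. The summand 0 only matches the shape of
    \<open>ennreal_le_epsilon\<close>.\<close>
  have J: "?J \<le> 0 + ennreal \<eta>" if \<eta>: "0 < \<eta>" for \<eta>
  proof -
    obtain \<delta> where \<delta>: "0 < \<delta>" and *:
     "\<And>u v. u \<in> borel_measurable lebesgue \<Longrightarrow> v \<in> borel_measurable lebesgue \<Longrightarrow>
       AE x in lebesgue. x \<notin> \<Omega> \<longrightarrow> u x = v x \<Longrightarrow>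
       energy p K \<Omega> u \<le> ennreal (r + \<delta>) \<Longrightarrow> energy p K \<Omega> v \<le> ennreal (r + \<delta>) \<Longrightarrow>
       ennreal r \<le> energy p K \<Omega> (\<lambda>x. (u x + v x) / 2) \<Longrightarrow>
       (\<integral>\<^sup>+x. indicator \<Omega> x * ennreal \<bar>u x - v x\<bar> \<partial>lebesgue) \<le> ennreal \<eta>"
      using near_minimizers_close[OF \<eta> r(2)] by blast
    have "?J \<le> ennreal \<eta>"
      using \<delta> r rw u(2)[OF admissible_midpoint[OF w(1) u(1)]]
      by (intro * admissible_eq[OF w(1) u(1)] admissible_measurable[OF u(1)] admissible_measurable[OF w(1)])
        (auto intro!: ennreal_leI)
    then show ?thesis by simp
  qed
  have "?J \<le> 0" by (rule ennreal_le_epsilon) (rule J)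
  then have "?J = 0" by simp
  then have "AE x in lebesgue. indicator \<Omega> x * ennreal \<bar>w x - u x\<bar> = 0"
    by (subst (asm) nn_integral_0_iff_AE) measurable
  then show ?thesis using admissible_eq[OF w(1) u(1)]
    by eventually_elim (auto simp: indicator_def split: if_splits)
qed

end

section \<open>Subcritical integrability\<close>

text \<open>The exponent \<open>\<alpha>\<close> is the fixed point of \<open>\<alpha> \<mapsto> p + \<sigma> \<alpha>\<close>; a value \<open>\<sigma> \<ge> 1\<close> may be lowered to any
  \<open>\<tau> < 1\<close> because \<open>b\<close> is bounded by \<open>1\<close>.\<close>
lemma dyadic_decay:
  fixes b :: "nat \<Rightarrow> real"
  assumes b: "\<And>j. J \<le> j \<Longrightarrow> 0 \<le> b j" "\<And>j. J \<le> j \<Longrightarrow> b j \<le> 1" and "0 \<le> C"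
    and step: "\<And>j. J \<le> j \<Longrightarrow> b (Suc j) \<le> C * b j powr \<sigma> / 2 powr (real j * p)"
    and \<tau>: "0 < \<tau>" "\<tau> < 1" "\<tau> \<le> \<sigma>" and \<alpha>: "\<alpha> = p / (1 - \<tau>)"
  obtains M where "\<And>j. J \<le> j \<Longrightarrow> b j \<le> M / 2 powr (real j * \<alpha>)"
proof -
  \<comment> \<open>The first entry settles the start j = J from b J \<le> 1. The second solves C
    2^\<alpha> M^\<tau> = M, which closes the induction step.\<close>
  define M where "M = max (2 powr (real J * \<alpha>)) ((C * 2 powr \<alpha>) powr (1 / (1 - \<tau>)))"
  have M: "0 < M" "C * 2 powr \<alpha> * M powr \<tau> \<le> M"
  proof -
    show "0 < M" by (auto simp: M_def less_max_iff_disj)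
    have "C * 2 powr \<alpha> = ((C * 2 powr \<alpha>) powr (1 / (1 - \<tau>))) powr (1 - \<tau>)"
      using \<tau> \<open>0 \<le> C\<close> by (simp add: powr_powr)
    also have "\<dots> \<le> M powr (1 - \<tau>)" using \<tau> by (intro powr_mono2) (auto simp: M_def)
    finally have "C * 2 powr \<alpha> * M powr \<tau> \<le> M powr (1 - \<tau>) * M powr \<tau>"
      by (intro mult_right_mono) auto
    then show "C * 2 powr \<alpha> * M powr \<tau> \<le> M" using \<open>0 < M\<close> by (simp flip: powr_add)
  qed
  have "b j \<le> M / 2 powr (real j * \<alpha>)" if "J \<le> j" for j
    using that
  proof (induction j rule: dec_induct)
    case base
    have "b J * 2 powr (real J * \<alpha>) \<le> 1 * 2 powr (real J * \<alpha>)"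
      using b(2)[of J] by (intro mult_right_mono) auto
    also have "\<dots> \<le> M" by (simp add: M_def)
    finally show ?case by (simp add: le_divide_eq)
  next
    case (step j)
    have "b j powr \<sigma> \<le> b j powr \<tau>"
      using b[of j] step(1) \<tau> by (intro powr_mono') auto
    also have "\<dots> \<le> (M / 2 powr (real j * \<alpha>)) powr \<tau>"
      using b[of j] step(1) \<tau> step.IH by (intro powr_mono2) auto
    also have "\<dots> = M powr \<tau> / 2 powr (real j * \<alpha> * \<tau>)"
      using M by (simp add: powr_divide powr_powr)
    finally have "C * b j powr \<sigma> / 2 powr (real j * p) \<le> C * (M powr \<tau> / 2 powr (real j * \<alpha> * \<tau>)) / 2 powr (real j * p)"
      using \<open>0 \<le> C\<close> by (intro divide_right_mono mult_left_mono) auto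
    with assms(4)[OF step(1)] have "b (Suc j) \<le> C * M powr \<tau> / (2 powr (real j * \<alpha> * \<tau>) * 2 powr (real j * p))"
      by simp
    also have "2 powr (real j * \<alpha> * \<tau>) * 2 powr (real j * p) = 2 powr (real j * \<alpha>)"
    proof -
      have "\<alpha> * \<tau> + p = \<alpha>" using \<tau> \<alpha> by (simp add: field_simps)
      then have "real j * (\<alpha> * \<tau> + p) = real j * \<alpha>" by simp
      then show ?thesis by (simp add: powr_add[symmetric] algebra_simps)
    qed
    also have "C * M powr \<tau> / 2 powr (real j * \<alpha>) = C * 2 powr \<alpha> * M powr \<tau> / 2 powr (real (Suc j) * \<alpha>)"
      by (simp add: powr_add algebra_simps)
    also have "\<dots> \<le> M / 2 powr (real (Suc j) * \<alpha>)" using M by (intro divide_right_mono) auto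
    finally show ?case .
  qed
  then show thesis by (rule that)
qed

text \<open>A dyadic layer decomposition: the values up to 2^J contribute at most a multiple of the
  finite measure of A, and the layer between 2^j and 2^(j+1) at most a multiple of 2^(j (q -
  \<alpha>)), a geometric series because q < \<alpha>.\<close>

lemma nn_integral_powr_finite_of_dyadic_decay:
  fixes h :: "'a \<Rightarrow> real"
  assumes [measurable]: "h \<in> borel_measurable M" "A \<in> sets M" and A: "emeasure M A < \<infinity>"
    and supp: "\<And>x. x \<notin> A \<Longrightarrow> h x = 0"
    and decay: "\<And>j. J \<le> j \<Longrightarrow> measure M {x \<in> space M. 2 powr real j < \<bar>h x\<bar>} \<le> D / 2 powr (real j * \<alpha>)"
    and q: "0 < q" "q < \<alpha>"
  shows "(\<integral>\<^sup>+x. ennreal (\<bar>h x\<bar> powr q) \<partial>M) < \<infinity>"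
proof -
  let ?E = "\<lambda>j. {x \<in> space M. 2 powr real j < \<bar>h x\<bar>}"
  have E: "emeasure M (?E j) = ennreal (measure M (?E j))" for j
  proof -
    have "?E j \<subseteq> A" using supp by fastforce
    then have "emeasure M (?E j) \<le> emeasure M A" by (intro emeasure_mono) auto
    then show ?thesis using A by (intro emeasure_eq_ennreal_measure) (auto simp: top_unique)
  qed
  have "(\<integral>\<^sup>+x. ennreal (\<bar>h x\<bar> powr q) \<partial>M) \<le> (\<integral>\<^sup>+x. ennreal ((2 powr real J) powr q) * indicator A x
      + (\<Sum>i. ennreal (2 powr (real (Suc (J + i)) * q)) * indicator (?E (J + i)) x) \<partial>M)"
  proof (intro nn_integral_mono)
    fix x assume x: "x \<in> space M"
    let ?S = "\<Sum>i. ennreal (2 powr (real (Suc (J + i)) * q)) * indicator (?E (J + i)) x"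
    show "ennreal (\<bar>h x\<bar> powr q) \<le> ennreal ((2 powr real J) powr q) * indicator A x + ?S"
    proof (cases "\<bar>h x\<bar> \<le> 2 powr real J")
      case True
      then have "\<bar>h x\<bar> powr q \<le> (2 powr real J) powr q" using q by (intro powr_mono2) auto
      then have "ennreal (\<bar>h x\<bar> powr q) \<le> ennreal ((2 powr real J) powr q) * indicator A x"
        using supp[of x] by (cases "x \<in> A") (auto intro: ennreal_leI)
      then show ?thesis by (simp add: add_increasing2)
    next
      case False
      have le_suminf: "f i \<le> suminf f" for f :: "nat \<Rightarrow> ennreal" and i
        using sum_le_suminf[of f "{i}"] by simp
      obtain m0 where "\<bar>h x\<bar> \<le> 2 powr real m0"
        using real_arch_pow[of 2 "\<bar>h x\<bar>"] by (auto simp: powr_realpow intro: less_imp_le)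
      then have ex: "\<bar>h x\<bar> \<le> 2 powr real (LEAST m. \<bar>h x\<bar> \<le> 2 powr real m)" by (rule LeastI)
      \<comment> \<open>By minimality |h x| lies above 2^(m-1) and not above 2^m. The point is
        therefore counted in the level set of index m - 1 = J + i, while the weight carries the
        exponent \<open>Suc (J + i)\<close>.\<close>
      define m where "m = (LEAST m. \<bar>h x\<bar> \<le> 2 powr real m)"
      have "J < m"
      proof (rule ccontr)
        assume "\<not> J < m"
        then have "(2::real) powr real m \<le> 2 powr real J" by simp
        with ex[folded m_def] have "\<bar>h x\<bar> \<le> 2 powr real J" by (rule order_trans)
        with False show False by simp
      qed
      then obtain i where i: "m = Suc (J + i)" by (auto dest: less_imp_Suc_add)
      have "\<not> \<bar>h x\<bar> \<le> 2 powr real (J + i)"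
        by (rule not_less_Least) (use i m_def in simp)
      then have "x \<in> ?E (J + i)" using x by simp
      have "\<bar>h x\<bar> powr q \<le> (2 powr real m) powr q"
        using ex q unfolding m_def by (intro powr_mono2) auto
      also have "\<dots> = 2 powr (real (Suc (J + i)) * q)" by (simp only: powr_powr i)
      finally have "ennreal (\<bar>h x\<bar> powr q) \<le> ennreal (2 powr (real (Suc (J + i)) * q)) * indicator (?E (J + i)) x"
        using \<open>x \<in> ?E (J + i)\<close> by (simp add: ennreal_leI)
      also have "\<dots> \<le> ?S"
        by (rule le_suminf[of "\<lambda>i. ennreal (2 powr (real (Suc (J + i)) * q)) * indicator (?E (J + i)) x"])
      finally show ?thesis by (simp add: add_increasing)
    qed
  qed
  also have "\<dots> = ennreal ((2 powr real J) powr q) * emeasure M A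
      + (\<Sum>i. ennreal (2 powr (real (Suc (J + i)) * q)) * emeasure M (?E (J + i)))"
    by (simp add: nn_integral_add nn_integral_cmult nn_integral_suminf)
  also have "(\<Sum>i. ennreal (2 powr (real (Suc (J + i)) * q)) * emeasure M (?E (J + i)))
      \<le> (\<Sum>i. ennreal (\<bar>D\<bar> * 2 powr q * (2 powr (q - \<alpha>)) ^ i))"
  proof (intro suminf_le summableI)
    fix i
    have "2 powr (real (Suc (J + i)) * q) * measure M (?E (J + i))
        \<le> 2 powr (real (Suc (J + i)) * q) * (\<bar>D\<bar> / 2 powr (real (J + i) * \<alpha>))"
      using decay[of "J + i"] by (intro mult_left_mono order_trans[OF decay] divide_right_mono) auto
    also have "\<dots> = \<bar>D\<bar> * 2 powr q * 2 powr (real (J + i) * (q - \<alpha>))"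
      by (simp add: powr_add powr_diff algebra_simps)
    also have "\<dots> \<le> \<bar>D\<bar> * 2 powr q * 2 powr (real i * (q - \<alpha>))"
      using q by (intro mult_left_mono powr_mono mult_right_mono_neg) auto
    also have "2 powr (real i * (q - \<alpha>)) = (2 powr (q - \<alpha>)) ^ i"
      by (simp add: powr_powr mult.commute flip: powr_realpow)
    finally show "ennreal (2 powr (real (Suc (J + i)) * q)) * emeasure M (?E (J + i))
        \<le> ennreal (\<bar>D\<bar> * 2 powr q * (2 powr (q - \<alpha>)) ^ i)"
      unfolding E by (simp add: ennreal_leI flip: ennreal_mult)
  qed
  also have "\<dots> = ennreal (\<Sum>i. \<bar>D\<bar> * 2 powr q * (2 powr (q - \<alpha>)) ^ i)"
  proof (intro suminf_ennreal2 summable_mult summable_geometric)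
    show "norm ((2::real) powr (q - \<alpha>)) < 1" using q powr_less_mono[of "q - \<alpha>" 0 2] by simp
  qed auto
  finally show ?thesis using A
    by (auto simp: ennreal_mult_less_top le_less_trans add_left_mono)
qed

context variable_order_energy
begin

lemma gagliardo_cong_AE:
  assumes "AE x in lebesgue. u x = v x"
  shows "gagliardo s p \<Omega> u = gagliardo s p \<Omega> v"
  unfolding gagliardo_def
  by (intro nn_integral_cong_AE, use AE_lebesgue_fst[OF assms, where ?'b = "real^'n"]
      AE_lebesgue_snd[OF assms, where ?'a = "real^'n"] in eventually_elim) simp

text \<open>Let \<open>x\<close> range over the set where \<open>\<bar>h\<bar> > 2t\<close> and \<open>y\<close> over the part of the ball of
  radius \<open>r\<close> around \<open>x\<close> where \<open>\<bar>h\<bar> \<le> t\<close>, with \<open>r\<close> chosen such that the ball has twice the volume of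
  the set where \<open>\<bar>h\<bar> > t\<close>.\<close>
lemma level_set_decay:
  fixes h :: "real^'n \<Rightarrow> real"
  assumes h[measurable]: "h \<in> borel_measurable borel" and supp: "\<And>x. x \<notin> \<Omega> \<Longrightarrow> h x = 0"
    and G: "gagliardo s p \<Omega> h \<le> ennreal G" "0 \<le> G" and t: "1 \<le> t"
    and small: "2 * measure lborel {x. t < \<bar>h x\<bar>} < measure lborel (ball (0 :: real^'n) 1)"
  shows "measure lborel {x. 2 * t < \<bar>h x\<bar>}
    \<le> G * (2 / measure lborel (ball (0 :: real^'n) 1)) powr (1 + inf_fun s * inf_fun p / real CARD('n))
      * measure lborel {x. t < \<bar>h x\<bar>} powr (inf_fun s * inf_fun p / real CARD('n)) / t powr inf_fun p"
proof -
  define E where "E t = {x. t < \<bar>h x\<bar>}" for t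
  define a where "a t = measure lborel (E t)" for t
  define \<omega> where "\<omega> = measure lborel (ball (0 :: real^'n) 1)"
  define \<beta> where "\<beta> = inf_fun s * inf_fun p"
  define N where "N = real CARD('n)"
  have \<omega>: "0 < \<omega>" unfolding \<omega>_def by (rule content_ball_pos) simp
  have \<beta>: "0 < \<beta>" using s_bounds(3) p_bounds(3) by (simp add: \<beta>_def)
  have N: "0 < N" by (simp add: N_def)
  have mE[measurable]: "E t \<in> sets borel" for t unfolding E_def by measurable
  have fin: "emeasure lborel (E t) = ennreal (a t)" if "0 \<le> t" for t
  proof -
    have "E t \<subseteq> \<Omega>" using supp that by (fastforce simp: E_def)
    then have "emeasure lborel (E t) < \<infinity>"
      using emeasure_bounded_finite bounded bounded_subset by blast
    then show ?thesis by (simp add: a_def emeasure_eq_ennreal_measure less_top)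
  qed
  have "a (2 * t) \<le> G * (2 / \<omega>) powr (1 + \<beta> / N) * a t powr (\<beta> / N) / t powr inf_fun p"
  proof (cases "a t = 0")
    case True
    \<comment> \<open>A null level set allows no ball of positive radius; here monotonicity of the
      level sets is enough.\<close>
    have "ennreal (a (2 * t)) \<le> ennreal (a t)"
      unfolding fin[symmetric, of t] using t
      by (subst fin[symmetric]) (auto simp: fin[symmetric] intro!: emeasure_mono simp: E_def)
    then show ?thesis using True by (simp add: a_def)
  next
    case False
    then have a: "0 < a t" by (simp add: a_def less_le)
    \<comment> \<open>Solves \<omega> r^n = 2 a t; the smallness hypothesis is exactly what gives r
      \<le> 1.\<close>
    define r where "r = (2 * a t / \<omega>) powr (1 / N)"
    have r: "0 < r" "r \<le> 1"
    proof -
      show "0 < r" using a \<omega> by (simp add: r_def)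
      show "r \<le> 1" unfolding r_def
        using small a \<omega> N by (intro powr_le1) (auto simp: a_def E_def \<omega>_def)
    qed
    have vol: "emeasure lborel (ball x r) = ennreal (2 * a t)" for x :: "real^'n"
    proof -
      have "measure lborel (ball x r) = r ^ CARD('n) * \<omega>"
        using r content_ball_conv_unit_ball[of r x] by (simp add: \<omega>_def)
      also have "r ^ CARD('n) = 2 * a t / \<omega>"
        using r a \<omega> N unfolding N_def by (simp add: r_def powr_powr N_def flip: powr_realpow)
      finally show ?thesis
        using emeasure_bounded_finite[of "ball x r"] \<omega> by (simp add: emeasure_eq_ennreal_measure)
    qed
    \<comment> \<open>Half of the ball's volume remains after removing the level set, wherever the
      centre is.\<close>
    have vol2: "ennreal (a t) \<le> emeasure lborel (ball x r - E t)" for x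
    proof -
      have "ennreal (a t) + ennreal (a t) = emeasure lborel (ball x r)"
        using a by (simp add: vol flip: ennreal_plus)
      also have "\<dots> \<le> emeasure lborel ((ball x r - E t) \<union> E t)" by (intro emeasure_mono) auto
      also have "\<dots> \<le> emeasure lborel (ball x r - E t) + emeasure lborel (E t)"
        by (intro emeasure_subadditive) auto
      also have "\<dots> = emeasure lborel (ball x r - E t) + ennreal (a t)" using t by (simp add: fin)
      finally show ?thesis by (simp add: ennreal_add_left_cancel_le add.commute)
    qed
    \<comment> \<open>A lower bound for the Gagliardo integrand on the chosen pairs: the increment
      is at least t \<ge> 1 and the distance is below r \<le> 1, so both variable exponents can be
      replaced by their infima.\<close>
    define c where "c = t powr inf_fun p / r powr (N + \<beta>)"
    have c: "0 < c" using t r by (simp add: c_def)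
    define F where "F z = indicator (E (2 * t)) (fst z) * (indicator (- E t) (snd z) * indicator {w. norm (fst w - snd w) < r} z) * ennreal c" for z :: "(real^'n) \<times> (real^'n)"
    note [measurable] = borel_fst_snd
    have "open {w :: (real^'n) \<times> (real^'n). norm (fst w - snd w) < r}"
      by (intro open_Collect_less continuous_intros)
    then have [measurable]: "{w :: (real^'n) \<times> (real^'n). norm (fst w - snd w) < r} \<in> sets borel" by simp
    have F[measurable]: "F \<in> borel_measurable borel" unfolding F_def by measurable
    have "ennreal c * (ennreal (a t) * ennreal (a (2 * t)))
        = (\<integral>\<^sup>+x. indicator (E (2 * t)) x * (ennreal (a t) * ennreal c) \<partial>lborel)"
      by (subst nn_integral_multc) (use t in \<open>auto simp: fin mult_ac\<close>)
    also have "\<dots> \<le> (\<integral>\<^sup>+x. indicator (E (2 * t)) x * (emeasure lborel (ball x r - E t) * ennreal c) \<partial>lborel)"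
      by (intro nn_integral_mono mult_left_mono mult_right_mono vol2) auto
    also have "\<dots> = (\<integral>\<^sup>+x. \<integral>\<^sup>+y. F (x, y) \<partial>lborel \<partial>lborel)"
    proof (intro nn_integral_cong)
      fix x
      have "(\<integral>\<^sup>+y. F (x, y) \<partial>lborel) = (\<integral>\<^sup>+y. indicator (E (2 * t)) x * ennreal c * indicator (ball x r - E t) y \<partial>lborel)"
        by (intro nn_integral_cong) (auto simp: F_def indicator_def dist_norm)
      also have "\<dots> = indicator (E (2 * t)) x * ennreal c * emeasure lborel (ball x r - E t)"
        by (intro nn_integral_cmult_indicator) auto
      finally show "indicator (E (2 * t)) x * (emeasure lborel (ball x r - E t) * ennreal c) = (\<integral>\<^sup>+y. F (x, y) \<partial>lborel)"
        by (simp add: mult_ac)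
    qed
    also have "\<dots> = (\<integral>\<^sup>+z. F z \<partial>lebesgue)"
      using nn_integral_lebesgue_pair[OF F] by (simp add: nn_integral_completion)
    also have "\<dots> \<le> gagliardo s p \<Omega> h" unfolding gagliardo_def
    proof (intro nn_integral_mono)
      fix z :: "(real^'n) \<times> (real^'n)"
      let ?x = "fst z" and ?y = "snd z"
      let ?p = "p ?x ?y" and ?e = "real CARD('n) + s ?x ?y * p ?x ?y"
      show "F z \<le> indicator (C_set \<Omega>) z * ennreal (\<bar>h ?x - h ?y\<bar> powr ?p / norm (?x - ?y) powr ?e)"
      proof (cases "2 * t < \<bar>h ?x\<bar> \<and> \<bar>h ?y\<bar> \<le> t \<and> norm (?x - ?y) < r")
        case True
        then have "?x \<in> \<Omega>" using supp[of ?x] t by (cases "?x \<in> \<Omega>") auto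
        then have C: "z \<in> C_set \<Omega>" by (cases z) (auto simp: C_set_def)
        have xy: "0 < norm (?x - ?y)" using True t by auto
        have "inf_fun s * inf_fun p \<le> s ?x ?y * ?p"
          using s_bounds(1,2,4)[of ?x ?y] s_bounds(3) p_bounds(1,2,4)[of ?x ?y] p_bounds(3)
          by (intro mult_mono) auto
        then have "norm (?x - ?y) powr ?e \<le> norm (?x - ?y) powr (N + \<beta>)"
          using True r xy by (intro powr_mono') (auto simp: N_def \<beta>_def)
        also have "\<dots> \<le> r powr (N + \<beta>)" using True N \<beta> by (intro powr_mono2) auto
        finally have n: "norm (?x - ?y) powr ?e \<le> r powr (N + \<beta>)" .
        have "t powr inf_fun p \<le> t powr ?p" using t p_bounds(1)[of ?x ?y] by (intro powr_mono) auto
        also have "\<dots> \<le> \<bar>h ?x - h ?y\<bar> powr ?p"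
          using True t p_bounds(4)[of ?x ?y] by (intro powr_mono2) auto
        finally have "c \<le> \<bar>h ?x - h ?y\<bar> powr ?p / norm (?x - ?y) powr ?e"
          unfolding c_def using n xy by (intro frac_le) auto
        then show ?thesis using C True by (auto simp: F_def indicator_def intro: ennreal_leI)
      qed (auto simp: F_def E_def indicator_def)
    qed
    also note G(1)
    finally have "ennreal (c * (a t * a (2 * t))) \<le> ennreal G"
      using c a by (simp add: ennreal_mult a_def)
    then have "c * (a t * a (2 * t)) \<le> G" using G(2) by simp
    then have "a (2 * t) \<le> G / (c * a t)" using c a by (simp add: field_simps)
    also have "G / (c * a t) = G * (r powr (N + \<beta>) / a t) / t powr inf_fun p"
      using t r by (simp add: c_def field_simps)
    \<comment> \<open>By the choice of r, r^(N + \<beta>) is proportional to (a t)^(1 + \<beta>/N).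
      The division by a t, which came from the integration in y, leaves the power \<beta>/N.\<close>
    also have "r powr (N + \<beta>) / a t = (2 / \<omega>) powr (1 + \<beta> / N) * a t powr (\<beta> / N)"
    proof -
      have "r powr (N + \<beta>) = (2 / \<omega> * a t) powr (1 + \<beta> / N)"
        using N by (simp add: r_def powr_powr add_divide_distrib)
      also have "\<dots> = (2 / \<omega>) powr (1 + \<beta> / N) * (a t * a t powr (\<beta> / N))"
        using a \<omega> by (subst powr_mult) (auto simp: powr_add)
      finally show ?thesis using a by simp
    qed
    finally show ?thesis by (simp add: mult.assoc)
  qed
  then show ?thesis by (simp add: a_def E_def \<omega>_def \<beta>_def N_def)
qed

text \<open>The recursion for the dyadic level sets yields decay at rate \<open>inf_fun p\<close> /
  (1 - \<tau>) for a suitable \<tau> \<le> \<sigma>. The hypothesis on q is what permits a \<tau>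
  for which this rate exceeds q.\<close>

lemma subcritical_integrable:
  fixes h :: "real^'n \<Rightarrow> real"
  assumes h: "h \<in> borel_measurable lebesgue" and supp: "AE x in lebesgue. x \<notin> \<Omega> \<longrightarrow> h x = 0"
    and fin: "gagliardo s p \<Omega> h < \<infinity>" and q: "0 < q"
    and sub: "q < real CARD('n) * inf_fun p / (real CARD('n) - inf_fun s * inf_fun p)
              \<or> real CARD('n) \<le> inf_fun s * inf_fun p"
  shows "(\<integral>\<^sup>+x. ennreal (\<bar>h x\<bar> powr q) \<partial>lebesgue) < \<infinity>"
proof -
  define \<sigma> where "\<sigma> = inf_fun s * inf_fun p / real CARD('n)"
  have N: "0 < real CARD('n)" by simp
  have p0: "1 < inf_fun p" by (rule p_bounds(3))
  have sp: "0 < inf_fun s * inf_fun p" using s_bounds(3) p0 by simp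
  \<comment> \<open>If \<sigma> \<ge> 1, \<tau> is taken so close to 1 that q (1 - \<tau>) < 1 <
    \<open>inf_fun p\<close>. Otherwise \<tau> = \<sigma>, and the last condition is the
    subcriticality of q multiplied out.\<close>
  obtain \<tau> where \<tau>: "0 < \<tau>" "\<tau> < 1" "\<tau> \<le> \<sigma>" "q * (1 - \<tau>) < inf_fun p"
  proof (cases "real CARD('n) \<le> inf_fun s * inf_fun p")
    case True
    define \<kappa> where "\<kappa> = 1 / (2 * (q + 1))"
    have \<kappa>: "0 < \<kappa>" "\<kappa> < 1" "q * \<kappa> < 1" using q by (simp_all add: \<kappa>_def pos_divide_less_eq)
    have "1 \<le> \<sigma>" using True N by (simp add: \<sigma>_def)
    with \<kappa> have "1 - \<kappa> \<le> \<sigma>" by linarith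
    moreover have "q * (1 - (1 - \<kappa>)) < inf_fun p" using \<kappa>(3) p0 by simp
    ultimately show thesis using \<kappa>(1,2) by (intro that[of "1 - \<kappa>"]) simp_all
  next
    case False
    then have "q * (real CARD('n) - inf_fun s * inf_fun p) < real CARD('n) * inf_fun p"
      using sub by (auto simp: less_divide_eq)
    then have "q * (real CARD('n) - inf_fun s * inf_fun p) / real CARD('n) < inf_fun p"
      using N by (simp add: divide_less_eq mult.commute)
    also have "q * (real CARD('n) - inf_fun s * inf_fun p) / real CARD('n) = q * (1 - \<sigma>)"
      using N by (simp add: \<sigma>_def field_simps)
    finally show thesis using False N sp by (intro that[of \<sigma>]) (auto simp: \<sigma>_def)
  qed
  define \<alpha> where "\<alpha> = inf_fun p / (1 - \<tau>)"
  have \<alpha>: "q < \<alpha>" using \<tau> by (simp add: \<alpha>_def less_divide_eq)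
  obtain h' where h'[measurable]: "h' \<in> borel_measurable borel" and hh': "AE x in lebesgue. h x = h' x"
    using lebesgue_borel_representative[OF h] .
  \<comment> \<open>A Borel version of h that vanishes at every point off \<Omega>, as the level set
    estimate requires; it differs from h only on a null set.\<close>
  define f where "f x = indicator \<Omega> x * h' x" for x
  have f[measurable]: "f \<in> borel_measurable borel" unfolding f_def by measurable
  have hf: "AE x in lebesgue. h x = f x"
    using hh' supp by eventually_elim (auto simp: f_def indicator_def)
  have f0: "f x = 0" if "x \<notin> \<Omega>" for x using that by (simp add: f_def)
  obtain G where G: "gagliardo s p \<Omega> f = ennreal G" "0 \<le> G"
    using fin unfolding gagliardo_cong_AE[OF hf] by (cases "gagliardo s p \<Omega> f") auto
  define b where "b j = measure lborel {x. 2 powr real j < \<bar>f x\<bar>}" for j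
  define \<omega> where "\<omega> = measure lborel (ball (0 :: real^'n) 1)"
  have \<omega>: "0 < \<omega>" unfolding \<omega>_def by (rule content_ball_pos) simp
  have fin\<Omega>: "emeasure lborel \<Omega> < \<infinity>" by (rule emeasure_bounded_finite[OF bounded])
  \<comment> \<open>The level sets decrease to the empty set because f is finite. This gives the
    starting index J, past which b j is below 1 for the recursion and below \<omega> / 2 for the
    radius.\<close>
  have "(\<lambda>j. measure lborel {x. 2 powr real j < \<bar>f x\<bar>}) \<longlonglongrightarrow> measure lborel (\<Inter>j. {x. 2 powr real j < \<bar>f x\<bar>})"
  proof (rule Lim_measure_decseq)
    show "range (\<lambda>j. {x. 2 powr real j < \<bar>f x\<bar>}) \<subseteq> sets lborel" by auto
    show "decseq (\<lambda>j. {x. 2 powr real j < \<bar>f x\<bar>})"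
      unfolding decseq_def
    proof (intro allI impI subsetI CollectI)
      fix m n x assume mn: "m \<le> n" and x: "x \<in> {x. 2 powr real n < \<bar>f x\<bar>}"
      have "(2::real) powr real m \<le> 2 powr real n" using mn by simp
      also have "\<dots> < \<bar>f x\<bar>" using x by simp
      finally show "2 powr real m < \<bar>f x\<bar>" .
    qed
    show "emeasure lborel {x. 2 powr real j < \<bar>f x\<bar>} \<noteq> \<infinity>" for j
    proof -
      have "{x. 2 powr real j < \<bar>f x\<bar>} \<subseteq> \<Omega>" using f0 by fastforce
      then have "emeasure lborel {x. 2 powr real j < \<bar>f x\<bar>} \<le> emeasure lborel \<Omega>"
        by (intro emeasure_mono) auto
      then show ?thesis using fin\<Omega> by (auto simp: top_unique)
    qed
  qed
  moreover have "(\<Inter>j. {x. 2 powr real j < \<bar>f x\<bar>}) = {}"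
  proof (intro equals0I)
    fix x assume x: "x \<in> (\<Inter>j. {x. 2 powr real j < \<bar>f x\<bar>})"
    obtain j where "\<bar>f x\<bar> < 2 ^ j" using real_arch_pow[of 2 "\<bar>f x\<bar>"] by auto
    moreover have "2 powr real j < \<bar>f x\<bar>" using x by auto
    ultimately show False by (simp add: powr_realpow)
  qed
  ultimately have "b \<longlonglongrightarrow> 0" unfolding b_def by simp
  then have "eventually (\<lambda>j. b j < min 1 (\<omega> / 2)) sequentially"
    using \<omega> by (intro order_tendstoD(2)) auto
  then obtain J where J: "\<And>j. J \<le> j \<Longrightarrow> b j < min 1 (\<omega> / 2)"
    by (auto simp: eventually_sequentially)
  define C where "C = G * (2 / \<omega>) powr (1 + \<sigma>)"
  have "b (Suc j) \<le> C * b j powr \<sigma> / 2 powr (real j * inf_fun p)" if "J \<le> j" for j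
  proof -
    have "1 \<le> (2::real) powr real j" by (intro ge_one_powr_ge_zero) auto
    then have "measure lborel {x. 2 * 2 powr real j < \<bar>f x\<bar>} \<le> C * b j powr \<sigma> / (2 powr real j) powr inf_fun p"
      unfolding C_def b_def \<sigma>_def \<omega>_def using J[OF that] G f0
      by (intro level_set_decay f) (auto simp: b_def \<omega>_def)
    moreover have "2 * 2 powr real j = (2::real) powr real (Suc j)" by (simp add: powr_add)
    ultimately show ?thesis by (simp add: b_def powr_powr)
  qed
  then obtain M where M: "\<And>j. J \<le> j \<Longrightarrow> b j \<le> M / 2 powr (real j * \<alpha>)"
    using dyadic_decay[of J b C \<sigma> "inf_fun p" \<tau> \<alpha>] J \<tau> G(2) by (auto simp: b_def C_def \<alpha>_def less_imp_le)
  have "(\<integral>\<^sup>+x. ennreal (\<bar>f x\<bar> powr q) \<partial>lborel) < \<infinity>"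
  proof (rule nn_integral_powr_finite_of_dyadic_decay[where J = J and A = \<Omega> and \<alpha> = \<alpha> and D = M])
    show "measure lborel {x \<in> space lborel. 2 powr real j < \<bar>f x\<bar>} \<le> M / 2 powr (real j * \<alpha>)"
      if "J \<le> j" for j using M[OF that] by (simp add: b_def)
  qed (use q \<alpha> f0 fin\<Omega> in auto)
  also have "(\<integral>\<^sup>+x. ennreal (\<bar>f x\<bar> powr q) \<partial>lborel) = (\<integral>\<^sup>+x. ennreal (\<bar>f x\<bar> powr q) \<partial>lebesgue)"
    by (simp add: nn_integral_completion)
  also have "\<dots> = (\<integral>\<^sup>+x. ennreal (\<bar>h x\<bar> powr q) \<partial>lebesgue)"
    by (intro nn_integral_cong_AE, use hf in eventually_elim) simp
  finally show ?thesis .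
qed

section \<open>Transfer of the tail bound from the datum to the minimizer\<close>

lemma energy_diff_finite:
  assumes u: "u \<in> borel_measurable lebesgue" "energy p K \<Omega> u < \<infinity>"
    and v: "v \<in> borel_measurable lebesgue" "energy p K \<Omega> v < \<infinity>"
  shows "energy p K \<Omega> (\<lambda>x. u x - v x) < \<infinity>"
proof -
  note [measurable] = u(1) v(1) lebesgue_measurable_fst[OF u(1)] lebesgue_measurable_snd[OF u(1)]
    lebesgue_measurable_fst[OF v(1)] lebesgue_measurable_snd[OF v(1)]
  let ?c = "2 powr sup_fun p"
  have "energy p K \<Omega> (\<lambda>x. u x - v x) \<le>
    (\<integral>\<^sup>+z. ennreal ?c * (ennreal (\<bar>u (fst z) - u (snd z)\<bar> powr p (fst z) (snd z))
        + ennreal (\<bar>v (fst z) - v (snd z)\<bar> powr p (fst z) (snd z))) \<partial>energy_measure)"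
  proof (subst energy_eq_nn_integral, measurable, intro nn_integral_mono)
    fix z :: "(real^'n) \<times> (real^'n)"
    let ?a = "u (fst z) - u (snd z)" and ?b = "v (fst z) - v (snd z)" and ?p = "p (fst z) (snd z)"
    have "\<bar>?a + - ?b\<bar> powr ?p \<le> 2 powr ?p * (\<bar>?a\<bar> powr ?p + \<bar>- ?b\<bar> powr ?p)"
      using p_bounds(4)[of "fst z" "snd z"] by (intro abs_add_powr_le) simp
    also have "\<dots> \<le> ?c * (\<bar>?a\<bar> powr ?p + \<bar>- ?b\<bar> powr ?p)"
      using p_bounds(2)[of "fst z" "snd z"] by (intro mult_right_mono) auto
    also have "?a + - ?b = u (fst z) - v (fst z) - (u (snd z) - v (snd z))" by simp
    also have "\<bar>- ?b\<bar> = \<bar>?b\<bar>" by (rule abs_minus_cancel)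
    finally have "ennreal (\<bar>u (fst z) - v (fst z) - (u (snd z) - v (snd z))\<bar> powr ?p)
        \<le> ennreal (?c * (\<bar>?a\<bar> powr ?p + \<bar>?b\<bar> powr ?p))" by (rule ennreal_leI)
    also have "\<dots> = ennreal ?c * (ennreal (\<bar>?a\<bar> powr ?p) + ennreal (\<bar>?b\<bar> powr ?p))"
      by (simp only: ennreal_mult ennreal_plus powr_ge_zero add_nonneg_nonneg)
    finally show "ennreal (\<bar>u (fst z) - v (fst z) - (u (snd z) - v (snd z))\<bar> powr ?p)
        \<le> ennreal ?c * (ennreal (\<bar>?a\<bar> powr ?p) + ennreal (\<bar>?b\<bar> powr ?p))" .
  qed
  also have "\<dots> = ennreal ?c * (energy p K \<Omega> u + energy p K \<Omega> v)"
    unfolding energy_eq_nn_integral[OF u(1)] energy_eq_nn_integral[OF v(1)]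
    by (subst nn_integral_cmult, measurable) (subst nn_integral_add, auto)
  finally show ?thesis using u v by (simp add: le_less_trans ennreal_mult_less_top)
qed

text \<open>Write u = g + h. The weight (1 + |y|)^(n + s p) is at least 1 and h vanishes off
  \<Omega>, so the tail integrand of h is at most 1 on \<Omega> plus |h|^(p^+ - 1). The integral of
  this bound is finite and independent of x.\<close>

lemma tail_space_admissible:
  assumes u: "u \<in> admissible g" and gW: "g \<in> W_space s p \<Omega>" and g: "g \<in> tail_space s p \<Omega>"
    and sub: "sup_fun p - 1 < real CARD('n) * inf_fun p / (real CARD('n) - inf_fun s * inf_fun p)
              \<or> real CARD('n) \<le> inf_fun s * inf_fun p"
  shows "u \<in> tail_space s p \<Omega>"
proof -
  define h where "h x = u x - g x" for x
  have um[measurable]: "u \<in> borel_measurable lebesgue" by (rule admissible_measurable[OF u])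
  have gm[measurable]: "g \<in> borel_measurable lebesgue" using gW by (simp add: W_space_iff)
  have hm[measurable]: "h \<in> borel_measurable lebesgue" unfolding h_def by measurable
  have h0: "AE x in lebesgue. x \<notin> \<Omega> \<longrightarrow> h x = 0"
    using u unfolding admissible_def by (auto simp: h_def)
  have "energy p K \<Omega> h < \<infinity>"
    using energy_diff_finite[OF um _ gm] u gW by (simp add: h_def[abs_def] admissible_def W_space_iff)
  then have "gagliardo s p \<Omega> h < \<infinity>" using energy_finite_iff[OF hm] by simp
  moreover have "0 < sup_fun p - 1" using p_bounds(2,4) by (meson diff_gt_0_iff_gt less_le_trans)
  ultimately have fin: "(\<integral>\<^sup>+x. ennreal (\<bar>h x\<bar> powr (sup_fun p - 1)) \<partial>lebesgue) < \<infinity>"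
    using subcritical_integrable[OF hm h0 _ _ sub] by blast
  define H where "H = emeasure lebesgue \<Omega> + (\<integral>\<^sup>+x. ennreal (\<bar>h x\<bar> powr (sup_fun p - 1)) \<partial>lebesgue)"
  have "emeasure lebesgue \<Omega> < \<infinity>"
    using emeasure_bounded_finite[OF bounded] sets_\<Omega> by simp
  then have "H < \<infinity>" using fin by (simp add: H_def)
  then obtain H' where H': "H = ennreal H'" "0 \<le> H'" by (cases H) auto
  obtain C where C: "AE x in lebesgue. x \<in> \<Omega> \<longrightarrow>
         (\<integral>\<^sup>+ y. ennreal (\<bar>g y\<bar> powr (p x y - 1) /
                  (1 + norm y) powr (real CARD('n) + s x y * p x y)) \<partial>lebesgue) \<le> ennreal C"
    using g by (auto simp: tail_space_def)
  define c where "c = 2 powr (sup_fun p)"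
  \<comment> \<open>The constant in \<open>tail_space\<close> may be a negative real, which
    \<open>ennreal\<close> sends to 0; \<open>max 0 C\<close> makes the final sum a sum of
    nonnegative reals.\<close>
  have "AE x in lebesgue. x \<in> \<Omega> \<longrightarrow>
         (\<integral>\<^sup>+ y. ennreal (\<bar>u y\<bar> powr (p x y - 1) /
                  (1 + norm y) powr (real CARD('n) + s x y * p x y)) \<partial>lebesgue) \<le> ennreal (c * (max 0 C + H'))"
    using C lebesgue_measurable_slice[OF measurable_data(1)] lebesgue_measurable_slice[OF measurable_data(2)]
  proof eventually_elim
    case (elim x)
    have [measurable]: "(\<lambda>y. s x y) \<in> borel_measurable lebesgue" "(\<lambda>y. p x y) \<in> borel_measurable lebesgue"
      using elim by auto
    have [measurable]: "(\<lambda>y::real^'n. norm y) \<in> borel_measurable lebesgue"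
      by (intro lebesgue_measurable_borel borel_measurable_norm)
    let ?w = "\<lambda>y. (1 + norm y) powr (real CARD('n) + s x y * p x y)"
    show ?case
    proof
      assume x: "x \<in> \<Omega>"
      have "(\<integral>\<^sup>+ y. ennreal (\<bar>u y\<bar> powr (p x y - 1) / ?w y) \<partial>lebesgue)
        \<le> (\<integral>\<^sup>+ y. ennreal c * (ennreal (\<bar>g y\<bar> powr (p x y - 1) / ?w y)
             + (indicator \<Omega> y + ennreal (\<bar>h y\<bar> powr (sup_fun p - 1)))) \<partial>lebesgue)"
      proof (intro nn_integral_mono_AE, use h0 in eventually_elim)
        case (elim y)
        let ?q = "p x y - 1"
        have q: "0 \<le> ?q" "?q \<le> sup_fun p - 1" using p_bounds(2,4)[of x y] by auto
        have w: "1 \<le> ?w y"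
          using s_bounds(4)[of x y] p_bounds(4)[of x y] by (intro ge_one_powr_ge_zero) auto
        have hq: "\<bar>h y\<bar> powr ?q \<le> indicator \<Omega> y + \<bar>h y\<bar> powr (sup_fun p - 1)"
          using powr_le_one_plus_powr[of "\<bar>h y\<bar>", OF _ q] elim by (cases "y \<in> \<Omega>") auto
        have "\<bar>u y\<bar> powr ?q \<le> 2 powr ?q * (\<bar>g y\<bar> powr ?q + \<bar>h y\<bar> powr ?q)"
          using abs_add_powr_le[OF q(1), of "g y" "h y"] by (simp add: h_def)
        also have "\<dots> \<le> c * (\<bar>g y\<bar> powr ?q + \<bar>h y\<bar> powr ?q)"
          using q by (intro mult_right_mono) (auto simp: c_def)
        finally have "\<bar>u y\<bar> powr ?q / ?w y \<le> c * (\<bar>g y\<bar> powr ?q + \<bar>h y\<bar> powr ?q) / ?w y"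
          using w by (intro divide_right_mono) auto
        also have "\<dots> = c * (\<bar>g y\<bar> powr ?q / ?w y + \<bar>h y\<bar> powr ?q / ?w y)"
          by (simp only: add_divide_distrib distrib_left times_divide_eq_right)
        also have "\<dots> \<le> c * (\<bar>g y\<bar> powr ?q / ?w y + (indicator \<Omega> y + \<bar>h y\<bar> powr (sup_fun p - 1)))"
        proof (intro mult_left_mono add_left_mono)
          have "\<bar>h y\<bar> powr ?q / ?w y \<le> \<bar>h y\<bar> powr ?q / 1" using w by (intro divide_left_mono) auto
          then show "\<bar>h y\<bar> powr ?q / ?w y \<le> indicator \<Omega> y + \<bar>h y\<bar> powr (sup_fun p - 1)" using hq by simp
        qed (simp add: c_def)
        finally have "ennreal (\<bar>u y\<bar> powr ?q / ?w y)
            \<le> ennreal (c * (\<bar>g y\<bar> powr ?q / ?w y + (indicator \<Omega> y + \<bar>h y\<bar> powr (sup_fun p - 1))))"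
          by (rule ennreal_leI)
        also have "\<dots> = ennreal c * (ennreal (\<bar>g y\<bar> powr ?q / ?w y)
             + (ennreal (indicator \<Omega> y) + ennreal (\<bar>h y\<bar> powr (sup_fun p - 1))))"
          by (simp only: c_def ennreal_mult ennreal_plus powr_ge_zero add_nonneg_nonneg
              divide_nonneg_nonneg indicator_pos_le)
        finally show ?case by (simp only: ennreal_indicator)
      qed
      also have "\<dots> = ennreal c * ((\<integral>\<^sup>+ y. ennreal (\<bar>g y\<bar> powr (p x y - 1) / ?w y) \<partial>lebesgue) + H)"
        unfolding H_def by (simp add: nn_integral_cmult nn_integral_add)
      also have "\<dots> \<le> ennreal c * (ennreal (max 0 C) + ennreal H')"
      proof -
        have "(\<integral>\<^sup>+ y. ennreal (\<bar>g y\<bar> powr (p x y - 1) / ?w y) \<partial>lebesgue) \<le> ennreal C"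
          using elim(1) x by simp
        also have "\<dots> \<le> ennreal (max 0 C)" by (intro ennreal_leI) simp
        finally show ?thesis unfolding H' by (intro mult_left_mono add_right_mono) auto
      qed
      also have "\<dots> = ennreal (c * (max 0 C + H'))"
        using H' by (simp add: c_def ennreal_mult)
      finally show "(\<integral>\<^sup>+ y. ennreal (\<bar>u y\<bar> powr (p x y - 1) / ?w y) \<partial>lebesgue) \<le> ennreal (c * (max 0 C + H'))" .
    qed
  qed
  then show ?thesis using um by (auto simp: tail_space_def)
qed

end

theorem theorem3p1:
  fixes s p K :: "real^'n \<Rightarrow> real^'n \<Rightarrow> real"
    and \<Omega> :: "(real^'n) set"
    and g :: "real^'n \<Rightarrow> real"
  assumes S: "standing_assumptions s p K"
    and \<Omega>: "bounded \<Omega>" "open \<Omega>" "lipschitz_domain \<Omega>"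
    and g: "g \<in> W_space s p \<Omega>"
  shows "\<exists>u. u \<in> W_space s p \<Omega> \<and> (AE x in lebesgue. x \<notin> \<Omega> \<longrightarrow> u x = g x) \<and>
          (\<forall>v. v \<in> W_space s p \<Omega> \<and> (AE x in lebesgue. x \<notin> \<Omega> \<longrightarrow> v x = g x)
                \<longrightarrow> energy p K \<Omega> u \<le> energy p K \<Omega> v) \<and>
          (\<forall>w. w \<in> W_space s p \<Omega> \<and> (AE x in lebesgue. x \<notin> \<Omega> \<longrightarrow> w x = g x) \<and>
                (\<forall>v. v \<in> W_space s p \<Omega> \<and> (AE x in lebesgue. x \<notin> \<Omega> \<longrightarrow> v x = g x)
                     \<longrightarrow> energy p K \<Omega> w \<le> energy p K \<Omega> v)
                \<longrightarrow> (AE x in lebesgue. w x = u x)) \<and>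
          ((sup_fun p - 1 < real CARD('n) * inf_fun p / (real CARD('n) - inf_fun s * inf_fun p)
              \<or> inf_fun s * inf_fun p \<ge> real CARD('n)) \<and> g \<in> tail_space s p \<Omega>
             \<longrightarrow> u \<in> tail_space s p \<Omega>)"
proof -
  interpret variable_order_energy s p K \<Omega>
    using S \<Omega>(1,2) by unfold_locales
  obtain u where u: "u \<in> admissible g" "\<And>v. v \<in> admissible g \<Longrightarrow> energy p K \<Omega> u \<le> energy p K \<Omega> v"
    using minimizer_exists[OF g] by blast
  have unique: "AE x in lebesgue. w x = u x"
    if "w \<in> admissible g" "\<And>v. v \<in> admissible g \<Longrightarrow> energy p K \<Omega> w \<le> energy p K \<Omega> v" for w
    using minimizer_unique[OF u that] .
  show ?thesis
  proof (intro exI[of _ u] conjI allI impI; (elim conjE)?)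
    show "u \<in> W_space s p \<Omega>" "AE x in lebesgue. x \<notin> \<Omega> \<longrightarrow> u x = g x"
      using u(1) by (auto simp: admissible_def)
    show "energy p K \<Omega> u \<le> energy p K \<Omega> v"
      if "v \<in> W_space s p \<Omega>" "AE x in lebesgue. x \<notin> \<Omega> \<longrightarrow> v x = g x" for v
      using that by (intro u(2)) (simp add: admissible_def)
    show "AE x in lebesgue. w x = u x"
      if "w \<in> W_space s p \<Omega>" "AE x in lebesgue. x \<notin> \<Omega> \<longrightarrow> w x = g x"
        "\<forall>v. v \<in> W_space s p \<Omega> \<and> (AE x in lebesgue. x \<notin> \<Omega> \<longrightarrow> v x = g x)
           \<longrightarrow> energy p K \<Omega> w \<le> energy p K \<Omega> v" for w
      using that by (intro unique) (simp_all add: admissible_def)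
    show "u \<in> tail_space s p \<Omega>"
      if "g \<in> tail_space s p \<Omega>"
        "sup_fun p - 1 < real CARD('n) * inf_fun p / (real CARD('n) - inf_fun s * inf_fun p)
              \<or> inf_fun s * inf_fun p \<ge> real CARD('n)"
      using tail_space_admissible[OF u(1) g that] .
  qed
qed

end
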